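(* Let $d\ge1$ and $\Omega=\mathbb{R}^d$. Let $w:\Omega\to[0,\infty)$ be integrable and compactly supported with $\int_\Omega w(x)\,dx=1$. Let $\varphi,\psi:\Omega\to\mathbb{R}$ be radial, i.e. of the form $x\mapsto\Phi(|x|)$ with $\Phi:[0,\infty)\to\mathbb{R}$ (a possibly different $\Phi$ for each), with $\nabla\varphi$ and $\nabla\psi$ globally Lipschitz continuous on $\Omega$. Let $f_0\in C_c^1(\Omega)$ be nonnegative with $\int_\Omega f_0(x)\,dx=1$, and let $f\in C^1(\Omega\times\mathbb{R}_+)$ be a classical solution of $$\partial_t f=\nabla\cdot\left(\nabla\mathcal K[f]\,f\right),\qquad f(\cdot,0)=f_0,\qquad \mathcal K[f](y,t):=\int_\Omega\left(w(x)\varphi(y-x)-f(x,t)\psi(y-x)\right)dx,$$ such that for every $t\ge0$ the function $f(\cdot,t)$ is nonnegative, compactly supported, and satisfies $\int_\Omega f(x,t)\,dx=1$. Then the energy $$\mathcal E[f]=\int_\Omega\int_\Omega w(x)\varphi(p-x)f(p)\,dx\,dp-\frac12\int_\Omega\int_\Omega f(x)\psi(p-x)f(p)\,dp\,dx$$ is nonincreasing along the solution: $$\frac{d}{dt}\mathcal E[f(\cdot,t)]\le 0.$$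
   Context: $|\cdot|$ denotes the Euclidean norm on $\mathbb{R}^d$, $\mathbb{R}_+=[0,\infty)$, and $C_c^1(\Omega)$ is the space of continuously differentiable compactly supported functions. All gradients and divergences are with respect to the space variable. *)

theory Defs
  imports "HOL-Analysis.Analysis"
begin

definition compactly_supported :: "('a::topological_space \<Rightarrow> real) \<Rightarrow> bool" where
  "compactly_supported g \<longleftrightarrow> compact (closure {x. g x \<noteq> 0})"

definition radial :: "('a::real_normed_vector \<Rightarrow> real) \<Rightarrow> bool" where
  "radial g \<longleftrightarrow> (\<exists>\<Phi> :: real \<Rightarrow> real. \<forall>x. g x = \<Phi> (norm x))"

text \<open>On a set with boundary, such as \<open>UNIV \<times> {0..}\<close>, the derivative is taken within
  the set (one-sided at the boundary) and is continuous up to the boundary.\<close>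

definition C1_on :: "'a::real_normed_vector set \<Rightarrow> ('a \<Rightarrow> 'b::real_normed_vector) \<Rightarrow> bool" where
  "C1_on S g \<longleftrightarrow>
     (\<exists>g' :: 'a \<Rightarrow> 'a \<Rightarrow>\<^sub>L 'b.
        (\<forall>z\<in>S. (g has_derivative blinfun_apply (g' z)) (at z within S)) \<and>
        continuous_on S g')"

definition gradient :: "('a::euclidean_space \<Rightarrow> real) \<Rightarrow> 'a \<Rightarrow> 'a" where
  "gradient g x = (THE D. GDERIV g x :> D)"

definition divergence_exists :: "('a::euclidean_space \<Rightarrow> 'a) \<Rightarrow> 'a \<Rightarrow> bool" where
  "divergence_exists V x \<longleftrightarrow>
     (\<forall>b\<in>Basis. (\<lambda>s::real. V (x + s *\<^sub>R b) \<bullet> b) differentiable (at 0))"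

definition divergence :: "('a::euclidean_space \<Rightarrow> 'a) \<Rightarrow> 'a \<Rightarrow> real" where
  "divergence V x = (\<Sum>b\<in>Basis. deriv (\<lambda>s::real. V (x + s *\<^sub>R b) \<bullet> b) 0)"

definition potential ::
  "('a::euclidean_space \<Rightarrow> real) \<Rightarrow> ('a \<Rightarrow> real) \<Rightarrow> ('a \<Rightarrow> real) \<Rightarrow> ('a \<Rightarrow> real) \<Rightarrow> 'a \<Rightarrow> real" where
  "potential w \<phi> \<psi> g y = (LINT x|lebesgue. w x * \<phi> (y - x) - g x * \<psi> (y - x))"

definition energy ::
  "('a::euclidean_space \<Rightarrow> real) \<Rightarrow> ('a \<Rightarrow> real) \<Rightarrow> ('a \<Rightarrow> real) \<Rightarrow> ('a \<Rightarrow> real) \<Rightarrow> real" where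
  "energy w \<phi> \<psi> g =
     (LINT p|lebesgue. LINT x|lebesgue. w x * \<phi> (p - x) * g p)
     - 1 / 2 * (LINT x|lebesgue. LINT p|lebesgue. g x * \<psi> (p - x) * g p)"

text \<open>As for any classical solution, all derivatives occurring in the equation are required
  to exist; without this, \<^const>\<open>gradient\<close> and \<^const>\<open>divergence\<close> would be unspecified.
  The time derivative at \<open>t = 0\<close> is one-sided.\<close>

definition classical_solution ::
  "('a::euclidean_space \<Rightarrow> real) \<Rightarrow> ('a \<Rightarrow> real) \<Rightarrow> ('a \<Rightarrow> real) \<Rightarrow> ('a \<Rightarrow> real) \<Rightarrow>
   ('a \<Rightarrow> real \<Rightarrow> real) \<Rightarrow> bool" where
  "classical_solution w \<phi> \<psi> f\<^sub>0 f \<longleftrightarrow>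
     C1_on (UNIV \<times> {0..}) (\<lambda>(x, t). f x t) \<and>
     (\<forall>x. f x 0 = f\<^sub>0 x) \<and>
     (\<forall>t\<ge>0.
        let K = potential w \<phi> \<psi> (\<lambda>x. f x t);
            F = (\<lambda>y. f y t *\<^sub>R gradient K y)
        in K differentiable_on UNIV \<and>
           (\<forall>y. divergence_exists F y \<and>
                ((\<lambda>s. f y s) has_real_derivative divergence F y) (at t within {0..})))"

end

theory Submission
  imports Defs
begin

text \<open>Write \<open>V = \<nabla>K\<close>. Since \<open>w\<close> and \<open>f\<close> have mass one, \<open>V\<close> is Lipschitz in space uniformly in time.
  Compactness of the support of each \<open>f (\<cdot>) t\<close> does not by itself allow differentiation under
  the integral: the supports must be bounded locally uniformly in \<open>t\<close>. For this, \<open>V\<close> at the origin is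
  locally bounded in time (otherwise \<open>\<partial>\<^sub>t f\<close> could not be), so the propagation speed grows at most
  linearly in space, and a maximum principle on backward cones confines the support.
  The energy then satisfies the exact expansion
  \<open>E(g) - E(h) = \<integral> K[h] (g - h) - 1/2 \<integral>\<integral> (g - h)(x) \<psi>(p - x) (g - h)(p)\<close>,
  whence \<open>dE/dt = \<integral> K \<partial>\<^sub>t f = \<integral> K div (f \<nabla>K) = - \<integral> f |\<nabla>K|\<^sup>2\<close>.
  The integration by parts uses only directional derivatives, via difference quotients and
  translation invariance of Lebesgue measure.\<close>

section \<open>Gradients and second differences\<close>

text \<open>The derivative is represented by the vector of its values on the basis, and uniqueness
  of derivatives makes the definite description in \<open>gradient\<close> pick this vector.\<close>

lemma GDERIV_gradient:
  fixes g :: "'a::euclidean_space \<Rightarrow> real"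
  assumes "g differentiable (at x)"
  shows "GDERIV g x :> gradient g x"
proof -
  obtain g' where g': "(g has_derivative g') (at x)"
    using assms by (auto simp: differentiable_def)
  then have lin: "linear g'" by (rule has_derivative_linear)
  define D where "D = (\<Sum>b\<in>Basis. g' b *\<^sub>R b)"
  have "g' h = h \<bullet> D" for h
  proof -
    have "g' h = g' (\<Sum>b\<in>Basis. (h \<bullet> b) *\<^sub>R b)" by (simp add: euclidean_representation)
    also have "\<dots> = (\<Sum>b\<in>Basis. (h \<bullet> b) * g' b)"
      by (simp add: linear_sum[OF lin] linear_cmul[OF lin])
    also have "\<dots> = h \<bullet> D" by (simp add: D_def inner_sum_right mult.commute)
    finally show ?thesis .
  qed
  then have "g' = (\<lambda>h. h \<bullet> D)" by auto
  with g' have D: "GDERIV g x :> D" by (simp add: gderiv_def)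
  moreover have "D' = D" if "GDERIV g x :> D'" for D'
  proof -
    have "(\<lambda>h. h \<bullet> D') = (\<lambda>h. h \<bullet> D)"
      using that D has_derivative_unique unfolding gderiv_def by blast
    then have "\<forall>h. h \<bullet> D' = h \<bullet> D" by meson
    then show ?thesis by (metis vector_eq_rdot inner_commute)
  qed
  ultimately show ?thesis unfolding gradient_def by (rule theI)
qed

lemma GDERIV_imp_DERIV_line:
  assumes "GDERIV g (a + s *\<^sub>R h) :> D"
  shows "((\<lambda>s. g (a + s *\<^sub>R h)) has_real_derivative (h \<bullet> D)) (at s)"
proof -
  have "((\<lambda>s. a + s *\<^sub>R h) has_derivative (\<lambda>r. r *\<^sub>R h)) (at s)"
    by (auto intro!: derivative_eq_intros)
  from has_derivative_compose[OF this assms[unfolded gderiv_def]]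
  show ?thesis by (simp add: has_field_derivative_def mult.commute mult_commute_abs)
qed

text \<open>Mean value theorem for \<open>g (a + s h) - g (b + s h)\<close> on the unit interval.
  The bound contains no derivative, so it passes through a convolution by linearity, without
  differentiation under the integral sign.\<close>

lemma second_difference_bound:
  fixes g :: "'a::euclidean_space \<Rightarrow> real"
  assumes "g differentiable_on UNIV" "L-lipschitz_on UNIV (gradient g)"
  shows "\<bar>(g (a + h) - g a) - (g (b + h) - g b)\<bar> \<le> L * norm (a - b) * norm h"
proof -
  let ?u = "\<lambda>s. g (a + s *\<^sub>R h) - g (b + s *\<^sub>R h)"
  let ?u' = "\<lambda>s. h \<bullet> (gradient g (a + s *\<^sub>R h) - gradient g (b + s *\<^sub>R h))"
  have "(?u has_real_derivative ?u' s) (at s)" for s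
    using assms(1) unfolding inner_diff_right
    by (intro DERIV_diff GDERIV_imp_DERIV_line GDERIV_gradient) (auto simp: differentiable_on_def)
  then obtain z where "?u 1 - ?u 0 = (1 - 0) * ?u' z"
    using MVT2[of 0 1 ?u ?u'] by auto
  then have "\<bar>?u 1 - ?u 0\<bar> \<le> norm h * norm (gradient g (a + z *\<^sub>R h) - gradient g (b + z *\<^sub>R h))"
    using Cauchy_Schwarz_ineq2 by simp
  also have "\<dots> \<le> norm h * (L * norm (a - b))"
    using lipschitz_onD[OF assms(2), of "a + z *\<^sub>R h" "b + z *\<^sub>R h"]
    by (intro mult_left_mono) (auto simp: dist_norm)
  finally show ?thesis by (simp add: algebra_simps)
qed

section \<open>Convolution with compactly supported densities\<close>

lemma compactly_supported_bound:
  fixes u :: "'a::euclidean_space \<Rightarrow> real"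
  assumes "compactly_supported u"
  obtains R where "R > 0" "\<And>x. norm x \<ge> R \<Longrightarrow> u x = 0"
proof -
  have "bounded {x. u x \<noteq> 0}"
    using assms unfolding compactly_supported_def
    by (meson bounded_subset closure_subset compact_imp_bounded)
  then obtain R where "R > 0" "\<forall>x\<in>{x. u x \<noteq> 0}. norm x < R"
    using bounded_pos_less by blast
  then show ?thesis using that[of R] by fastforce
qed

definition convolution :: "('a::euclidean_space \<Rightarrow> real) \<Rightarrow> ('a \<Rightarrow> real) \<Rightarrow> 'a \<Rightarrow> real" where
  "convolution u k y = (LINT x|lebesgue. u x * k (y - x))"

text \<open>As \<open>u\<close> vanishes outside a ball, only values of \<open>k\<close> on a larger
  compact ball matter while \<open>y\<close> stays bounded. The factor \<open>M\<close> does not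
  depend on \<open>y\<close>, so \<open>M * \<bar>u x\<bar>\<close> serves as dominating function
  when \<open>y\<close> varies.\<close>

lemma convolution_locally_dominated:
  fixes u k :: "'a::euclidean_space \<Rightarrow> real"
  assumes "compactly_supported u" "continuous_on UNIV k"
  obtains M where "\<And>x y. norm y \<le> r \<Longrightarrow> \<bar>u x * k (y - x)\<bar> \<le> M * \<bar>u x\<bar>"
proof -
  obtain R where R: "\<And>x. norm x \<ge> R \<Longrightarrow> u x = 0"
    using compactly_supported_bound[OF assms(1)] by blast
  have "bounded (k ` cball 0 (r + R))"
    using assms(2) by (intro compact_imp_bounded compact_continuous_image)
      (auto intro: continuous_on_subset)
  then obtain M where M: "\<And>z. norm z \<le> r + R \<Longrightarrow> \<bar>k z\<bar> \<le> M"
    unfolding bounded_iff by fastforce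
  have "\<bar>u x * k (y - x)\<bar> \<le> M * \<bar>u x\<bar>" if "norm y \<le> r" for x y
  proof (cases "norm x \<ge> R")
    case False
    then have "\<bar>k (y - x)\<bar> \<le> M"
      using that norm_triangle_ineq4[of y x] by (intro M) linarith
    then show ?thesis using mult_right_mono[of "\<bar>k (y - x)\<bar>" M "\<bar>u x\<bar>"] by (simp add: abs_mult mult.commute)
  qed (use R in simp)
  then show ?thesis by (rule that)
qed

lemma continuous_translate_measurable:
  fixes k :: "'a::euclidean_space \<Rightarrow> real"
  assumes "continuous_on UNIV k"
  shows "(\<lambda>x. k (y - x)) \<in> borel_measurable borel"
  by (intro borel_measurable_continuous_onI continuous_on_compose2[OF assms] continuous_intros) auto

lemma integrable_convolution:
  fixes u k :: "'a::euclidean_space \<Rightarrow> real"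
  assumes "integrable lebesgue u" "compactly_supported u" "continuous_on UNIV k"
  shows "integrable lebesgue (\<lambda>x. u x * k (y - x))"
proof -
  obtain M where "\<And>x z. norm z \<le> norm y \<Longrightarrow> \<bar>u x * k (z - x)\<bar> \<le> M * \<bar>u x\<bar>"
    using convolution_locally_dominated[OF assms(2,3)] by blast
  then have M: "\<bar>u x * k (y - x)\<bar> \<le> M * \<bar>u x\<bar>" for x by blast
  have "(\<lambda>x. k (y - x)) \<in> borel_measurable lebesgue"
    using continuous_translate_measurable[OF assms(3)] by (simp add: measurable_completion)
  then have meas: "(\<lambda>x. u x * k (y - x)) \<in> borel_measurable lebesgue"
    using assms(1) by (intro borel_measurable_times) auto
  show ?thesis
  proof (rule Bochner_Integration.integrable_bound[OF _ meas AE_I2])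
    show "integrable lebesgue (\<lambda>x. M * \<bar>u x\<bar>)"
      using assms(1) by simp
    show "norm (u x * k (y - x)) \<le> norm (M * \<bar>u x\<bar>)" for x
      using M[of x] unfolding real_norm_def by linarith
  qed
qed

lemma continuous_on_convolution:
  fixes u k :: "'a::euclidean_space \<Rightarrow> real"
  assumes "integrable lebesgue u" "compactly_supported u" "continuous_on UNIV k"
  shows "continuous_on UNIV (convolution u k)"
  unfolding convolution_def
proof (rule continuous_on_sequentiallyI)
  fix Y :: "nat \<Rightarrow> 'a" and y
  assume Y: "Y \<longlonglongrightarrow> y"
  then obtain r where r: "\<And>n. norm (Y n) \<le> r"
    using convergent_imp_bounded[OF Y] by (auto simp: bounded_iff)
  obtain M where M: "\<And>x z. norm z \<le> r \<Longrightarrow> \<bar>u x * k (z - x)\<bar> \<le> M * \<bar>u x\<bar>"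
    using convolution_locally_dominated[OF assms(2,3)] by blast
  show "(\<lambda>n. LINT x|lebesgue. u x * k (Y n - x)) \<longlonglongrightarrow> (LINT x|lebesgue. u x * k (y - x))"
  proof (rule integral_dominated_convergence[where w = "\<lambda>x. M * \<bar>u x\<bar>"])
    have "(\<lambda>n. u x * k (Y n - x)) \<longlonglongrightarrow> u x * k (y - x)" for x
      using assms(3) by (intro tendsto_intros isCont_tendsto_compose[of _ k] Y)
        (simp add: continuous_on_eq_continuous_at)
    then show "AE x in lebesgue. (\<lambda>n. u x * k (Y n - x)) \<longlonglongrightarrow> u x * k (y - x)" by simp
    show "integrable lebesgue (\<lambda>x. M * \<bar>u x\<bar>)"
      using assms(1) by simp
    show "AE x in lebesgue. norm (u x * k (Y n - x)) \<le> M * \<bar>u x\<bar>" for n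
      unfolding real_norm_def by (intro AE_I2 M r)
  qed (intro borel_measurable_integrable integrable_convolution[OF assms])+
qed

section \<open>Lipschitz gradient of the potential\<close>

lemma potential_eq:
  assumes "integrable lebesgue w" "compactly_supported w" "continuous_on UNIV \<phi>"
    and "integrable lebesgue g" "compactly_supported g" "continuous_on UNIV \<psi>"
  shows "potential w \<phi> \<psi> g y = convolution w \<phi> y - convolution g \<psi> y"
  unfolding potential_def convolution_def
  by (rule Bochner_Integration.integral_diff[OF integrable_convolution[OF assms(1-3)]
        integrable_convolution[OF assms(4-6)]])

text \<open>The bound for \<open>k\<close> is applied at the translated points \<open>a - x\<close>
  and \<open>b - x\<close> and averaged over the probability density \<open>u\<close>, which leaves
  the constant \<open>L\<close> unchanged.\<close>

lemma convolution_second_difference_bound: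
  fixes u k :: "'a::euclidean_space \<Rightarrow> real"
  assumes u: "integrable lebesgue u" "compactly_supported u" "\<And>x. u x \<ge> 0" "(LINT x|lebesgue. u x) = 1"
    and k: "k differentiable_on UNIV" "L-lipschitz_on UNIV (gradient k)"
  defines "c \<equiv> convolution u k"
  shows "\<bar>(c (a + h) - c a) - (c (b + h) - c b)\<bar> \<le> L * norm (a - b) * norm h"
proof -
  have int: "integrable lebesgue (\<lambda>x. u x * k (y - x))" for y
    by (intro integrable_convolution u differentiable_imp_continuous_on k)
  let ?d = "\<lambda>x. u x * k (a + h - x) - u x * k (a - x) - (u x * k (b + h - x) - u x * k (b - x))"
  have "(c (a + h) - c a) - (c (b + h) - c b) = (LINT x|lebesgue. ?d x)"
    unfolding c_def convolution_def by (simp add: int)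
  then have "\<bar>(c (a + h) - c a) - (c (b + h) - c b)\<bar> \<le> (LINT x|lebesgue. \<bar>?d x\<bar>)"
    by (simp only: integral_abs_bound)
  also have "\<dots> \<le> (LINT x|lebesgue. u x * (L * norm (a - b) * norm h))"
  proof (rule Bochner_Integration.integral_mono)
    fix x
    have "?d x = u x * ((k ((a - x) + h) - k (a - x)) - (k ((b - x) + h) - k (b - x)))"
      by (simp only: right_diff_distrib diff_add_eq)
    then show "\<bar>?d x\<bar> \<le> u x * (L * norm (a - b) * norm h)"
      using mult_left_mono[OF second_difference_bound[OF k, of "a - x" h "b - x"] u(3)[of x]]
      by (simp only: abs_mult abs_of_nonneg[OF u(3)] diff_diff_eq2 diff_add_cancel)
  next
    show "integrable lebesgue (\<lambda>x. \<bar>?d x\<bar>)"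
      by (intro integrable_abs Bochner_Integration.integrable_diff int)
    show "integrable lebesgue (\<lambda>x. u x * (L * norm (a - b) * norm h))"
      by (intro integrable_mult_left u)
  qed
  also have "\<dots> = L * norm (a - b) * norm h" using u(1,4) by simp
  finally show ?thesis .
qed

text \<open>Converse of \<open>second_difference_bound\<close>. With \<open>h = s v\<close>, where
  \<open>v\<close> is the difference of the two gradients, dividing by \<open>s\<close> and letting
  \<open>s\<close> tend to 0 yields
  \<open>norm v * norm v \<le> L * norm (a - b) * norm v\<close>.\<close>

lemma lipschitz_gradient_of_second_differences:
  fixes K :: "'a::euclidean_space \<Rightarrow> real"
  assumes K: "K differentiable_on UNIV" and "L \<ge> 0"
    and bnd: "\<And>a b h. \<bar>(K (a + h) - K a) - (K (b + h) - K b)\<bar> \<le> L * norm (a - b) * norm h"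
  shows "L-lipschitz_on UNIV (gradient K)"
proof (rule lipschitz_onI)
  fix a b :: 'a
  define v where "v = gradient K a - gradient K b"
  have G: "GDERIV K x :> gradient K x" for x
    using K by (intro GDERIV_gradient) (auto simp: differentiable_on_def)
  let ?u = "\<lambda>s. K (a + s *\<^sub>R v) - K (b + s *\<^sub>R v)"
  have "(?u has_real_derivative (v \<bullet> gradient K (a + 0 *\<^sub>R v) - v \<bullet> gradient K (b + 0 *\<^sub>R v))) (at 0)"
    by (intro DERIV_diff GDERIV_imp_DERIV_line G)
  then have "(?u has_real_derivative (v \<bullet> v)) (at 0)"
    by (simp add: v_def inner_diff_right)
  then have "(\<lambda>s. \<bar>(?u s - ?u 0) / (s - 0)\<bar>) \<midarrow>0\<rightarrow> \<bar>v \<bullet> v\<bar>"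
    unfolding has_field_derivative_iff by (intro tendsto_rabs)
  moreover have "\<bar>(?u s - ?u 0) / (s - 0)\<bar> \<le> L * norm (a - b) * norm v" if "s \<noteq> 0" for s
    using bnd[of a "s *\<^sub>R v" b] that by (simp add: abs_divide divide_le_eq algebra_simps)
  ultimately have "\<bar>v \<bullet> v\<bar> \<le> L * norm (a - b) * norm v"
    by (intro tendsto_upperbound[of _ _ "at (0::real)"]) (auto simp: eventually_at_filter)
  then have "norm v * norm v \<le> (L * norm (a - b)) * norm v"
    by (simp add: dot_square_norm power2_eq_square)
  then have "norm v \<le> L * norm (a - b)"
    using \<open>L \<ge> 0\<close> by (cases "v = 0") auto
  then show "dist (gradient K a) (gradient K b) \<le> L * dist a b"
    by (simp add: v_def dist_norm)
qed fact

text \<open>The constant \<open>A + B\<close> depends only on the kernels and not on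
  \<open>g\<close>, so the velocity field of a solution is Lipschitz uniformly in time.
  Differentiability of the potential enters as a hypothesis, which \<open>classical_solution\<close>
  provides.\<close>

lemma lipschitz_gradient_potential:
  fixes w \<phi> \<psi> g :: "'a::euclidean_space \<Rightarrow> real"
  assumes w: "integrable lebesgue w" "compactly_supported w" "\<And>x. w x \<ge> 0" "(LINT x|lebesgue. w x) = 1"
    and \<phi>: "\<phi> differentiable_on UNIV" "A-lipschitz_on UNIV (gradient \<phi>)"
    and g: "integrable lebesgue g" "compactly_supported g" "\<And>x. g x \<ge> 0" "(LINT x|lebesgue. g x) = 1"
    and \<psi>: "\<psi> differentiable_on UNIV" "B-lipschitz_on UNIV (gradient \<psi>)"
    and K: "potential w \<phi> \<psi> g differentiable_on UNIV"
  shows "(A + B)-lipschitz_on UNIV (gradient (potential w \<phi> \<psi> g))"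
proof (rule lipschitz_gradient_of_second_differences[OF K])
  show "0 \<le> A + B" using lipschitz_on_nonneg[OF \<phi>(2)] lipschitz_on_nonneg[OF \<psi>(2)] by simp
  fix a b h :: 'a
  note eq = potential_eq[OF w(1,2) differentiable_imp_continuous_on[OF \<phi>(1)]
      g(1,2) differentiable_imp_continuous_on[OF \<psi>(1)]]
  show "\<bar>(potential w \<phi> \<psi> g (a + h) - potential w \<phi> \<psi> g a)
      - (potential w \<phi> \<psi> g (b + h) - potential w \<phi> \<psi> g b)\<bar> \<le> (A + B) * norm (a - b) * norm h"
    using convolution_second_difference_bound[OF w \<phi>, of a h b]
      convolution_second_difference_bound[OF g \<psi>, of a h b]
    unfolding eq by (simp add: algebra_simps abs_le_iff)
qed

section \<open>Integrals of compactly supported functions and of directional derivatives\<close>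

lemma compactly_supportedI:
  fixes u :: "'a::euclidean_space \<Rightarrow> real"
  assumes "\<And>x. norm x \<ge> R \<Longrightarrow> u x = 0"
  shows "compactly_supported u"
proof -
  have "{x. u x \<noteq> 0} \<subseteq> cball 0 R"
    using assms by (force simp: not_le[symmetric])
  then have "bounded {x. u x \<noteq> 0}" by (rule bounded_subset[OF bounded_cball])
  then show ?thesis by (simp add: compactly_supported_def)
qed

lemma compactly_supported_mult:
  fixes u v :: "'a::euclidean_space \<Rightarrow> real"
  assumes "compactly_supported u"
  shows "compactly_supported (\<lambda>x. u x * v x)" "compactly_supported (\<lambda>x. v x * u x)"
proof -
  obtain R where "\<And>x. norm x \<ge> R \<Longrightarrow> u x = 0"
    using compactly_supported_bound[OF assms] by blast
  then show "compactly_supported (\<lambda>x. u x * v x)" "compactly_supported (\<lambda>x. v x * u x)"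
    by (auto intro!: compactly_supportedI[of R])
qed

lemma compactly_supported_diff:
  fixes u v :: "'a::euclidean_space \<Rightarrow> real"
  assumes "compactly_supported u" "compactly_supported v"
  shows "compactly_supported (\<lambda>x. u x - v x)"
proof -
  obtain R S where "\<And>x. norm x \<ge> R \<Longrightarrow> u x = 0" "\<And>x. norm x \<ge> S \<Longrightarrow> v x = 0"
    using compactly_supported_bound assms by metis
  then show ?thesis by (intro compactly_supportedI[of "max R S"]) simp
qed

lemma integrable_continuous_compactly_supported:
  fixes u :: "'a::euclidean_space \<Rightarrow> real"
  assumes "continuous_on UNIV u" "compactly_supported u"
  shows "integrable lborel u" "integrable lebesgue u"
proof -
  obtain R where R: "\<And>x. norm x \<ge> R \<Longrightarrow> u x = 0"
    using compactly_supported_bound[OF assms(2)] by blast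
  have "integrable lborel (\<lambda>x. indicator (cball 0 R) x *\<^sub>R u x)"
    using assms(1) by (intro borel_integrable_compact) (auto intro: continuous_on_subset)
  also have "(\<lambda>x. indicator (cball 0 R) x *\<^sub>R u x) = u"
    using R linear by (fastforce simp: indicator_def)
  finally show "integrable lborel u" .
  then show "integrable lebesgue u" by (simp add: integrable_completion)
qed

lemma lebesgue_integral_continuous:
  fixes u :: "'a::euclidean_space \<Rightarrow> real"
  assumes "continuous_on UNIV u"
  shows "(LINT x|lebesgue. u x) = (LINT x|lborel. u x)"
  using borel_measurable_continuous_onI[OF assms] by (intro integral_completion) simp

lemma abs_integral_le_cball:
  fixes u :: "'a::euclidean_space \<Rightarrow> real"
  assumes "C \<ge> 0" and "\<And>x. norm x \<le> R \<Longrightarrow> \<bar>u x\<bar> \<le> C" and "\<And>x. norm x \<ge> R \<Longrightarrow> u x = 0"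
  shows "\<bar>LINT x|lebesgue. u x\<bar> \<le> C * measure lebesgue (cball 0 R :: 'a set)"
proof -
  have "\<bar>LINT x|lebesgue. u x\<bar> \<le> (LINT x|lebesgue. \<bar>u x\<bar>)" by (rule integral_abs_bound)
  also have "\<dots> \<le> (LINT x|lebesgue. C * indicator (cball (0::'a) R) x)"
  proof (rule Bochner_Integration.integral_mono')
    have "emeasure lebesgue (cball (0::'a) R) < \<infinity>"
      using emeasure_compact_finite[OF compact_cball] by (simp add: fmeasurable_def)
    then show "integrable lebesgue (\<lambda>x::'a. C * indicator (cball 0 R) x)"
      by (intro integrable_mult_right integrable_real_indicator) auto
    show "\<bar>u x\<bar> \<le> C * indicator (cball 0 R) x" for x
      using assms(2)[of x] assms(3)[of x] by (auto simp: indicator_def)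
  qed (use assms(1) in auto)
  also have "\<dots> = C * measure lebesgue (cball 0 R :: 'a set)" by simp
  finally show ?thesis .
qed

text \<open>The difference quotients of \<open>G\<close> have integral zero by translation
  invariance. The mean value theorem bounds them by \<open>M\<close> and their supports lie in one
  ball, so dominated convergence passes to the limit. \<open>G'\<close> is not assumed continuous;
  it is measurable as a pointwise limit. This fits a flux component that is known to be
  differentiable only along its own axis.\<close>

lemma integral_directional_derivative:
  fixes G G' :: "'a::euclidean_space \<Rightarrow> real"
  assumes cont: "continuous_on UNIV G" and "compactly_supported G" and b: "norm b = 1"
    and deriv: "\<And>x. ((\<lambda>s. G (x + s *\<^sub>R b)) has_real_derivative G' x) (at 0)"
    and bound: "\<And>x. \<bar>G' x\<bar> \<le> M"
  shows "integrable lebesgue G'" "(LINT x|lebesgue. G' x) = 0"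
proof -
  obtain R where R: "\<And>x. norm x \<ge> R \<Longrightarrow> G x = 0"
    using compactly_supported_bound[OF assms(2)] by blast
  define h where "h = (\<lambda>n. inverse (real (Suc n)))"
  have h: "h n > 0" "h n \<le> 1" for n by (auto simp: h_def inverse_le_1_iff)
  have h0: "filterlim h (at 0) sequentially"
    unfolding filterlim_at using LIMSEQ_inverse_real_of_nat h(1)
    by (auto simp: h_def)
  define q where "q = (\<lambda>n x. (G (x + h n *\<^sub>R b) - G x) / h n)"
  \<comment> \<open>The hypothesis speaks of the derivative at parameter 0 for every base point;
    moving the base point gives all parameters.\<close>
  have line: "((\<lambda>s. G (x + s *\<^sub>R b)) has_real_derivative G' (x + s *\<^sub>R b)) (at s)" for x s
    using deriv[of "x + s *\<^sub>R b"]
      DERIV_shift[where f = "\<lambda>s. G (x + s *\<^sub>R b)" and x = 0 and z = s and y = "G' (x + s *\<^sub>R b)"]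
    by (simp add: algebra_simps)
  have q_lim: "(\<lambda>n. q n x) \<longlonglongrightarrow> G' x" for x
    using filterlim_compose[OF deriv[of x, unfolded has_field_derivative_iff] h0] by (simp add: q_def)
  have "M \<ge> 0" using bound[of 0] by linarith
  \<comment> \<open>The radius grows by 1 because the shift \<open>h n *\<^sub>R b\<close> has norm
    at most 1.\<close>
  have q_bound: "norm (q n x) \<le> M * indicator (cball 0 (R + 1)) x" for n x
  proof (cases "x \<in> cball 0 (R + 1)")
    case True
    obtain z where "G (x + h n *\<^sub>R b) - G (x + 0 *\<^sub>R b) = (h n - 0) * G' (x + z *\<^sub>R b)"
      using MVT2[OF h(1)[of n], of "\<lambda>s. G (x + s *\<^sub>R b)" "\<lambda>s. G' (x + s *\<^sub>R b)"] line by blast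
    then have "q n x = G' (x + z *\<^sub>R b)" using h(1)[of n] by (simp add: q_def)
    then show ?thesis using bound True by simp
  next
    case False
    then have "norm x \<ge> R" "norm (x + h n *\<^sub>R b) \<ge> R"
      using norm_triangle_ineq2[of x "- (h n *\<^sub>R b)"] h[of n] b by auto
    then show ?thesis using False R by (simp add: q_def)
  qed
  have G_shift_cont: "continuous_on UNIV (\<lambda>x. G (c + x))" for c
    by (intro continuous_on_compose2[OF cont] continuous_intros) auto
  have G_int: "integrable lborel G"
    by (rule integrable_continuous_compactly_supported(1)[OF assms(1,2)])
  have G_meas: "G \<in> borel_measurable borel"
    by (rule borel_measurable_continuous_onI[OF cont])
  have q_meas: "q n \<in> borel_measurable lborel" for n
    using borel_measurable_continuous_onI[OF G_shift_cont, of "h n *\<^sub>R b"] G_meas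
    unfolding q_def by (simp add: add.commute)
  have G'_meas: "G' \<in> borel_measurable lborel"
    by (rule borel_measurable_LIMSEQ_metric[OF q_meas q_lim])
  have "integrable lborel (\<lambda>x::'a. M * indicator (cball 0 (R + 1)) x)"
    by (intro integrable_mult_right integrable_real_indicator emeasure_lborel_cball_finite) auto
  note dct = this AE_I2[OF q_lim] AE_I2[OF q_bound]
  have "integrable lborel G'"
    by (rule integrable_dominated_convergence[OF G'_meas q_meas dct])
  then show "integrable lebesgue G'" using G'_meas by (simp add: integrable_completion)
  have "(LINT x|lborel. q n x) = 0" for n
  proof -
    have "(LINT x|lborel. G (h n *\<^sub>R b + x)) = (LINT x|lborel. G x)"
      using integral_distr[of "(+) (h n *\<^sub>R b)" lborel borel G] G_meas
      by (simp only: lborel_distr_plus) simp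
    moreover have "integrable lborel (\<lambda>x. G (h n *\<^sub>R b + x))"
      using integrable_distr_eq[of "(+) (h n *\<^sub>R b)" lborel borel G] G_meas G_int
      by (simp only: lborel_distr_plus) simp
    ultimately show ?thesis using G_int by (simp add: q_def add.commute)
  qed
  moreover have "(\<lambda>n. LINT x|lborel. q n x) \<longlonglongrightarrow> (LINT x|lborel. G' x)"
    by (rule integral_dominated_convergence[OF G'_meas q_meas dct])
  ultimately have "(LINT x|lborel. G' x) = 0" by (simp add: LIMSEQ_const_iff)
  then show "(LINT x|lebesgue. G' x) = 0" using G'_meas by (simp add: integral_completion)
qed

section \<open>Exact quadratic expansion of the energy\<close>

text \<open>Fubini's theorem combined with evenness of \<open>k\<close>. Continuity of all functions
  allows the passage from \<open>lebesgue\<close> to \<open>lborel\<close>, whose product is again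
  \<open>lborel\<close>; there the integrand is continuous with compact support, hence
  integrable.\<close>

lemma convolution_bilinear_symmetric:
  fixes u v k :: "'a::euclidean_space \<Rightarrow> real"
  assumes u: "continuous_on UNIV u" "compactly_supported u"
    and v: "continuous_on UNIV v" "compactly_supported v"
    and k: "continuous_on UNIV k" "\<And>x. k (- x) = k x"
  shows "(LINT x|lebesgue. u x * convolution v k x) = (LINT x|lebesgue. v x * convolution u k x)"
proof -
  obtain R S where R: "\<And>x. norm x \<ge> R \<Longrightarrow> u x = 0" and S: "\<And>x. norm x \<ge> S \<Longrightarrow> v x = 0"
    using compactly_supported_bound u(2) v(2) by metis
  let ?F = "\<lambda>(x, y). u x * (v y * k (x - y))"
  have F_cont: "continuous_on UNIV ?F"
    unfolding case_prod_unfold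
    by (intro continuous_intros continuous_on_compose2[OF u(1)] continuous_on_compose2[OF v(1)]
        continuous_on_compose2[OF k(1)]) auto
  have "integrable lborel (\<lambda>z. indicator (cball 0 R \<times> cball 0 S) z *\<^sub>R ?F z)"
    by (intro borel_integrable_compact compact_Times continuous_on_subset[OF F_cont]) auto
  also have "(\<lambda>z. indicator (cball 0 R \<times> cball 0 S) z *\<^sub>R ?F z) = ?F"
  proof -
    have "u x \<noteq> 0 \<Longrightarrow> norm x \<le> R" "v x \<noteq> 0 \<Longrightarrow> norm x \<le> S" for x
      using R[of x] S[of x] by linarith+
    then show ?thesis by (auto simp: indicator_def fun_eq_iff)
  qed
  finally have F_int: "integrable (lborel \<Otimes>\<^sub>M lborel) ?F" by (simp add: lborel_prod)
  have eq: "(LINT x|lebesgue. u' x * convolution v' k x) = (LINT x|lborel. LINT y|lborel. u' x * (v' y * k (x - y)))"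
    if u': "continuous_on UNIV u'" and v': "continuous_on UNIV v'" "compactly_supported v'" for u' v'
  proof -
    have "continuous_on UNIV (\<lambda>x. u' x * convolution v' k x)"
      by (intro continuous_intros u' continuous_on_convolution v' k
          integrable_continuous_compactly_supported)
    then have "(LINT x|lebesgue. u' x * convolution v' k x) = (LINT x|lborel. u' x * convolution v' k x)"
      by (rule lebesgue_integral_continuous)
    moreover have "convolution v' k x = (LINT y|lborel. v' y * k (x - y))" for x
      unfolding convolution_def
      by (intro lebesgue_integral_continuous continuous_intros v' continuous_on_compose2[OF k(1)]) auto
    ultimately show ?thesis by simp
  qed
  have "(LINT x|lebesgue. u x * convolution v k x) = (LINT x|lborel. LINT y|lborel. u x * (v y * k (x - y)))"
    by (rule eq[OF u(1) v])
  also have "\<dots> = (LINT y|lborel. LINT x|lborel. u x * (v y * k (x - y)))"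
    by (rule lborel_pair.Fubini_integral[OF F_int, symmetric])
  also have "\<dots> = (LINT y|lborel. LINT x|lborel. v y * (u x * k (y - x)))"
  proof -
    have "k (x - y) = k (y - x)" for x y using k(2)[of "y - x"] by simp
    then show ?thesis by (simp add: mult.left_commute)
  qed
  also have "\<dots> = (LINT x|lebesgue. v x * convolution u k x)"
    by (rule eq[OF v(1) u, symmetric])
  finally show ?thesis .
qed

text \<open>The kernel in the energy is \<open>\<psi> (p - x)\<close> with \<open>p\<close>
  integrated first; evenness turns it into the \<open>\<psi> (x - p)\<close> of a convolution at
  \<open>x\<close>.\<close>

lemma energy_eq:
  fixes w \<phi> \<psi> g :: "'a::euclidean_space \<Rightarrow> real"
  assumes "\<And>x. \<psi> (- x) = \<psi> x"
  shows "energy w \<phi> \<psi> g = (LINT x|lebesgue. convolution w \<phi> x * g x)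
    - 1 / 2 * (LINT x|lebesgue. g x * convolution g \<psi> x)"
proof -
  have "g x * \<psi> (p - x) * g p = g x * (g p * \<psi> (x - p))" for x p
    using assms[of "x - p"] by simp
  then have "(LINT p|lebesgue. g x * \<psi> (p - x) * g p) = g x * convolution g \<psi> x" for x
    by (simp only: integral_mult_right_zero convolution_def)
  then show ?thesis unfolding energy_def by (simp add: convolution_def)
qed

text \<open>The energy is a linear plus a quadratic functional, so its expansion about
  \<open>h\<close> stops at second order. By symmetry of the bilinear form the two cross terms
  agree, their sum cancels the factor 1/2, and the coefficient of \<open>d\<close> becomes the
  potential of \<open>h\<close>.\<close>

lemma energy_difference:
  fixes w \<phi> \<psi> g h :: "'a::euclidean_space \<Rightarrow> real"
  assumes w: "integrable lebesgue w" "compactly_supported w" and \<phi>: "continuous_on UNIV \<phi>"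
    and \<psi>: "continuous_on UNIV \<psi>" "\<And>x. \<psi> (- x) = \<psi> x"
    and g: "continuous_on UNIV g" "compactly_supported g"
    and h: "continuous_on UNIV h" "compactly_supported h"
  defines "d \<equiv> \<lambda>x. g x - h x"
  shows "energy w \<phi> \<psi> g - energy w \<phi> \<psi> h =
    (LINT x|lebesgue. potential w \<phi> \<psi> h x * d x) - 1 / 2 * (LINT x|lebesgue. d x * convolution d \<psi> x)"
proof -
  have d: "continuous_on UNIV d" "compactly_supported d"
    unfolding d_def using g h by (auto intro: continuous_intros compactly_supported_diff)
  note cs = integrable_continuous_compactly_supported(2)
  have conv: "continuous_on UNIV (convolution u \<psi>)" if "continuous_on UNIV u" "compactly_supported u" for u
    using that \<psi>(1) by (intro continuous_on_convolution cs)
  have int: "integrable lebesgue (\<lambda>x. u x * convolution v \<psi> x)"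
    if "continuous_on UNIV u" "compactly_supported u" "continuous_on UNIV v" "compactly_supported v" for u v
    by (intro cs continuous_on_mult conv compactly_supported_mult(1) that)
  have intw: "integrable lebesgue (\<lambda>x. convolution w \<phi> x * u x)"
    if "continuous_on UNIV u" "compactly_supported u" for u
    by (intro cs continuous_on_mult continuous_on_convolution[OF w \<phi>] compactly_supported_mult(2) that)
  have g_eq: "g x = h x + d x" for x by (simp add: d_def)
  have "convolution g \<psi> x = convolution h \<psi> x + convolution d \<psi> x" for x
    unfolding convolution_def g_eq distrib_right
    by (rule Bochner_Integration.integral_add; rule integrable_convolution; (rule cs)?; fact)
  then have "(LINT x|lebesgue. g x * convolution g \<psi> x)
      = (LINT x|lebesgue. (h x * convolution h \<psi> x + h x * convolution d \<psi> x)
          + (d x * convolution h \<psi> x + d x * convolution d \<psi> x))"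
    by (simp add: g_eq algebra_simps)
  also have "\<dots> = (LINT x|lebesgue. h x * convolution h \<psi> x) + (LINT x|lebesgue. h x * convolution d \<psi> x)
      + ((LINT x|lebesgue. d x * convolution h \<psi> x) + (LINT x|lebesgue. d x * convolution d \<psi> x))"
    by (simp add: int h d)
  also have "(LINT x|lebesgue. h x * convolution d \<psi> x) = (LINT x|lebesgue. d x * convolution h \<psi> x)"
    by (rule convolution_bilinear_symmetric[OF h d \<psi>])
  finally have quad: "(LINT x|lebesgue. g x * convolution g \<psi> x) =
      (LINT x|lebesgue. h x * convolution h \<psi> x) + 2 * (LINT x|lebesgue. d x * convolution h \<psi> x)
      + (LINT x|lebesgue. d x * convolution d \<psi> x)"
    by simp
  have lin: "(LINT x|lebesgue. convolution w \<phi> x * g x)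
      = (LINT x|lebesgue. convolution w \<phi> x * h x) + (LINT x|lebesgue. convolution w \<phi> x * d x)"
    unfolding g_eq distrib_left by (intro Bochner_Integration.integral_add intw h d)
  have "potential w \<phi> \<psi> h x * d x = convolution w \<phi> x * d x - d x * convolution h \<psi> x" for x
    unfolding potential_eq[OF w \<phi> cs[OF h] h(2) \<psi>(1)] by (simp add: algebra_simps)
  then have "(LINT x|lebesgue. potential w \<phi> \<psi> h x * d x)
      = (LINT x|lebesgue. convolution w \<phi> x * d x) - (LINT x|lebesgue. d x * convolution h \<psi> x)"
    by (simp add: int intw h d)
  then show ?thesis
    unfolding energy_eq[where \<psi> = \<psi>, OF \<psi>(2)] quad lin by (simp add: algebra_simps)
qed

section \<open>The continuity equation with a Lipschitz velocity field\<close>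

text \<open>The velocity is kept abstract: what is retained of the potential is a Lipschitz bound in
  space with one constant for all times. No regularity of \<open>V\<close> in time is assumed, and
  that \<open>V\<close> is a gradient enters only in \<open>dissipation_identity\<close>. The
  function \<open>f'\<close> is the joint derivative in space and time, and \<open>f_nonzero\<close>
  stands for the unit mass.\<close>

locale transport_solution =
  fixes f :: "'a::euclidean_space \<Rightarrow> real \<Rightarrow> real"
    and f' :: "'a \<times> real \<Rightarrow> ('a \<times> real) \<Rightarrow>\<^sub>L real"
    and V :: "real \<Rightarrow> 'a \<Rightarrow> 'a" and L :: real
  assumes f_deriv: "t \<ge> 0 \<Longrightarrow>
      ((\<lambda>(x, t). f x t) has_derivative blinfun_apply (f' (x, t))) (at (x, t) within UNIV \<times> {0..})"
    and f'_cont: "continuous_on (UNIV \<times> {0..}) f'"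
    and V_lipschitz: "t \<ge> 0 \<Longrightarrow> L-lipschitz_on UNIV (V t)"
    and div_exists: "t \<ge> 0 \<Longrightarrow> divergence_exists (\<lambda>y. f y t *\<^sub>R V t y) y"
    and evolution: "t \<ge> 0 \<Longrightarrow>
      ((\<lambda>s. f y s) has_real_derivative divergence (\<lambda>y. f y t *\<^sub>R V t y) y) (at t within {0..})"
    and f_nonneg: "t \<ge> 0 \<Longrightarrow> f x t \<ge> 0"
    and f_supp: "t \<ge> 0 \<Longrightarrow> compactly_supported (\<lambda>x. f x t)"
    and f_nonzero: "t \<ge> 0 \<Longrightarrow> \<exists>x. f x t \<noteq> 0"
begin

lemma L_nonneg: "L \<ge> 0"
  using V_lipschitz[of 0] lipschitz_on_nonneg by auto

lemma f_cont: "continuous_on (UNIV \<times> {0..}) (\<lambda>(x, t). f x t)"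
  using f_deriv by (auto intro!: has_derivative_continuous_on[where f' = f'])

lemma f_slice_cont: "t \<ge> 0 \<Longrightarrow> continuous_on UNIV (\<lambda>x. f x t)"
  by (rule continuous_on_compose2[OF f_cont, of UNIV "\<lambda>x. (x, t)", simplified])
    (auto intro!: continuous_intros)

lemma f'_apply_cont: "continuous_on (UNIV \<times> {0..}) (\<lambda>z. f' z v)"
  by (intro continuous_intros f'_cont)

lemma f'_slice_cont: "t \<ge> 0 \<Longrightarrow> continuous_on UNIV (\<lambda>x. f' (x, t) v)"
  by (rule continuous_on_compose2[OF f'_apply_cont, of UNIV "\<lambda>x. (x, t)"])
    (auto intro!: continuous_intros)

lemma V_cont: "t \<ge> 0 \<Longrightarrow> continuous_on UNIV (V t)"
  using V_lipschitz lipschitz_on_continuous_on by blast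

lemma space_deriv:
  assumes "t \<ge> 0"
  shows "((\<lambda>s. f (x + s *\<^sub>R v) t) has_real_derivative f' (x + s *\<^sub>R v, t) (v, 0)) (at s)"
proof -
  have "((\<lambda>s. (x + s *\<^sub>R v, t)) has_derivative (\<lambda>r. r *\<^sub>R (v, 0))) (at s)"
    by (auto intro!: derivative_eq_intros)
  moreover have "(\<lambda>s. (x + s *\<^sub>R v, t)) ` UNIV \<subseteq> UNIV \<times> {0..}"
    using assms by auto
  ultimately have "((\<lambda>s. (\<lambda>(x, t). f x t) (x + s *\<^sub>R v, t)) has_derivative
      (\<lambda>r. f' (x + s *\<^sub>R v, t) (r *\<^sub>R (v, 0)))) (at s)"
    using has_derivative_in_compose2[of "UNIV \<times> {0..}" "\<lambda>(x, t). f x t" f' "\<lambda>s. (x + s *\<^sub>R v, t)" UNIV s]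
      f_deriv by auto
  then show ?thesis
    by (simp only: has_field_derivative_def blinfun.scaleR_right split_conv real_scaleR_def mult_commute_abs)
qed

lemma time_deriv:
  assumes "t \<ge> 0"
  shows "((\<lambda>s. f x s) has_real_derivative f' (x, t) (0, 1)) (at t within {0..})"
proof -
  have "((\<lambda>s. (x, s)) has_derivative (\<lambda>r. r *\<^sub>R (0, 1))) (at t within {0..})"
    by (auto intro!: derivative_eq_intros)
  moreover have "(\<lambda>s. (x, s)) ` {0..} \<subseteq> UNIV \<times> {0..}"
    by auto
  ultimately have "((\<lambda>s. (\<lambda>(x, t). f x t) (x, s)) has_derivative
      (\<lambda>r. f' (x, t) (r *\<^sub>R (0, 1)))) (at t within {0..})"
    using has_derivative_in_compose2[of "UNIV \<times> {0..}" "\<lambda>(x, t). f x t" f' "\<lambda>s. (x, s)" "{0..}" t]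
      f_deriv assms by auto
  then show ?thesis
    by (simp only: has_field_derivative_def blinfun.scaleR_right split_conv real_scaleR_def mult_commute_abs)
qed

text \<open>Both sides are derivatives of the same function within \<open>{0..}\<close>. These are
  unique because \<open>t\<close> is a limit point of the half-line from the right, also for
  \<open>t = 0\<close>.\<close>

lemma time_deriv_eq_divergence:
  assumes "t \<ge> 0"
  shows "f' (x, t) (0, 1) = divergence (\<lambda>y. f y t *\<^sub>R V t y) x"
proof -
  have "at_right t \<le> at t within {0..}"
    using assms by (intro at_le) auto
  then have "at t within {0..} \<noteq> bot"
    using trivial_limit_at_right_real[of t] by (auto simp: bot_unique)
  then show ?thesis
    using time_deriv[OF assms, of x] evolution[OF assms, of x]
    unfolding has_field_derivative_iff by (rule tendsto_unique)
qed

text \<open>The difference quotient of the flux is that of \<open>f\<close>, times the shifted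
  velocity component, plus \<open>f y t\<close> times the difference quotient of \<open>V t\<close>
  along \<open>b\<close>. The last quotient may fail to converge but is bounded by \<open>L\<close>,
  and the bound survives in the limit.\<close>

lemma flux_deriv_estimate:
  assumes "t \<ge> 0" and b: "b \<in> Basis"
  shows "\<bar>deriv (\<lambda>s. (f (y + s *\<^sub>R b) t *\<^sub>R V t (y + s *\<^sub>R b)) \<bullet> b) 0 - f' (y, t) (b, 0) * (V t y \<bullet> b)\<bar>
    \<le> L * f y t"
proof -
  define G where "G = (\<lambda>s. (f (y + s *\<^sub>R b) t *\<^sub>R V t (y + s *\<^sub>R b)) \<bullet> b)"
  define q where "q = (\<lambda>s. (f (y + s *\<^sub>R b) t - f y t) / s)"
  have "G differentiable (at 0)"
    using div_exists[OF assms(1), of y] b by (auto simp: divergence_exists_def G_def)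
  then have "(G has_real_derivative deriv G 0) (at 0)"
    using DERIV_deriv_iff_real_differentiable by blast
  then have G: "((\<lambda>s. (G s - G 0) / s) \<longlongrightarrow> deriv G 0) (at 0)"
    by (simp add: has_field_derivative_iff)
  have q: "(q \<longlongrightarrow> f' (y, t) (b, 0)) (at 0)"
    using space_deriv[OF assms(1), of y b 0] by (simp add: has_field_derivative_iff q_def)
  have "continuous_on UNIV (\<lambda>s::real. V t (y + s *\<^sub>R b))"
    by (intro continuous_intros continuous_on_compose2[OF V_cont[OF assms(1)]]) auto
  then have "isCont (\<lambda>s::real. V t (y + s *\<^sub>R b)) 0"
    by (simp add: continuous_on_eq_continuous_at)
  then have V: "((\<lambda>s::real. V t (y + s *\<^sub>R b)) \<longlongrightarrow> V t y) (at 0)"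
    by (simp add: isCont_def)
  have "((\<lambda>s. \<bar>(G s - G 0) / s - q s * (V t (y + s *\<^sub>R b) \<bullet> b)\<bar>) \<longlongrightarrow>
      \<bar>deriv G 0 - f' (y, t) (b, 0) * (V t y \<bullet> b)\<bar>) (at 0)"
    by (intro tendsto_intros G q V)
  moreover have "\<bar>(G s - G 0) / s - q s * (V t (y + s *\<^sub>R b) \<bullet> b)\<bar> \<le> L * f y t" if "s \<noteq> 0" for s
  proof -
    have "(G s - G 0) / s - q s * (V t (y + s *\<^sub>R b) \<bullet> b)
        = f y t * ((V t (y + s *\<^sub>R b) - V t y) \<bullet> b) / s"
      using that by (simp add: G_def q_def field_simps inner_diff_left)
    moreover have "\<bar>(V t (y + s *\<^sub>R b) - V t y) \<bullet> b\<bar> \<le> L * \<bar>s\<bar>"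
      using lipschitz_onD[OF V_lipschitz[OF assms(1)], of "y + s *\<^sub>R b" y] b
        Cauchy_Schwarz_ineq2[of "V t (y + s *\<^sub>R b) - V t y" b]
      by (simp add: dist_norm)
    then have "f y t * \<bar>(V t (y + s *\<^sub>R b) - V t y) \<bullet> b\<bar> \<le> f y t * (L * \<bar>s\<bar>)"
      using f_nonneg[OF assms(1)] by (intro mult_left_mono)
    ultimately show ?thesis
      using that f_nonneg[OF assms(1), of y]
      by (simp add: abs_mult abs_divide divide_le_eq mult_ac)
  qed
  ultimately have "\<bar>deriv G 0 - f' (y, t) (b, 0) * (V t y \<bullet> b)\<bar> \<le> L * f y t"
    by (intro tendsto_upperbound[of _ _ "at (0::real)"]) (auto simp: eventually_at_filter)
  then show ?thesis by (simp add: G_def)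
qed

lemma space_derivative_expand:
  "f' z (v, 0) = (\<Sum>b\<in>Basis. f' z (b, 0) * (v \<bullet> b))"
proof -
  have "(v, 0::real) = (\<Sum>b\<in>Basis. (v \<bullet> b) *\<^sub>R (b, 0))"
    by (simp add: sum_prod euclidean_representation)
  then show ?thesis
    by (simp only: blinfun.sum_right blinfun.scaleR_right real_scaleR_def mult.commute)
qed

text \<open>The divergence of \<open>V\<close> need not exist where \<open>f\<close> vanishes, so the product rule for
  \<open>div (f V)\<close> is replaced by an inequality.\<close>

lemma transport_estimate:
  assumes "t \<ge> 0"
  shows "\<bar>f' (y, t) (0, 1) - f' (y, t) (V t y, 0)\<bar> \<le> real DIM('a) * L * f y t"
proof -
  have "\<bar>f' (y, t) (0, 1) - f' (y, t) (V t y, 0)\<bar>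
      = \<bar>\<Sum>b\<in>Basis. deriv (\<lambda>s. (f (y + s *\<^sub>R b) t *\<^sub>R V t (y + s *\<^sub>R b)) \<bullet> b) 0 - f' (y, t) (b, 0) * (V t y \<bullet> b)\<bar>"
    unfolding time_deriv_eq_divergence[OF assms] divergence_def space_derivative_expand[of _ "V t y"]
    by (simp add: sum_subtractf)
  also have "\<dots> \<le> (\<Sum>b\<in>(Basis::'a set). L * f y t)"
    by (intro order_trans[OF sum_abs] sum_mono flux_deriv_estimate assms)
  finally show ?thesis by (simp add: mult_ac)
qed

section \<open>Locally uniform bounds on the supports\<close>

lemma V_growth:
  assumes "t \<ge> 0"
  shows "norm (V t x) \<le> norm (V t 0) + L * norm x"
  using lipschitz_onD[OF V_lipschitz[OF assms], of x 0] norm_triangle_sub[of "V t x" "V t 0"]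
  by (simp add: dist_norm)

text \<open>If \<open>V (T n) 0\<close> were unbounded along times \<open>T n\<close> tending to \<open>t\<^sub>0\<close>, dividing the equation by its norm and
  passing to the limit would give a direction along which \<open>f (\<cdot>) t\<^sub>0\<close> is constant; a compactly
  supported function with this property is zero.\<close>

lemma V_locally_bounded:
  assumes "t\<^sub>0 \<ge> 0"
  shows "\<exists>\<delta>>0. \<exists>C. \<forall>t\<ge>0. \<bar>t - t\<^sub>0\<bar> \<le> \<delta> \<longrightarrow> norm (V t 0) \<le> C"
proof (rule ccontr)
  assume neg: "\<not> ?thesis"
  have "\<exists>t\<ge>0. \<bar>t - t\<^sub>0\<bar> \<le> inverse (real (Suc n)) \<and> norm (V t 0) > real (Suc n)" for n
  proof (rule ccontr)
    assume "\<not> (\<exists>t\<ge>0. \<bar>t - t\<^sub>0\<bar> \<le> inverse (real (Suc n)) \<and> norm (V t 0) > real (Suc n))"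
    then have "\<forall>t\<ge>0. \<bar>t - t\<^sub>0\<bar> \<le> inverse (real (Suc n)) \<longrightarrow> norm (V t 0) \<le> real (Suc n)"
      by (auto simp: not_less)
    moreover have "inverse (real (Suc n)) > 0" by simp
    ultimately show False using neg by blast
  qed
  then obtain T where T: "\<And>n. T n \<ge> 0" "\<And>n. \<bar>T n - t\<^sub>0\<bar> \<le> inverse (real (Suc n))"
    and big: "\<And>n. norm (V (T n) 0) > real (Suc n)"
    by metis
  define A where "A = (\<lambda>n. inverse (norm (V (T n) 0)))"
  have pos: "norm (V (T n) 0) > 0" for n
    using big[of n] by linarith
  have A_le: "\<bar>A n\<bar> \<le> inverse (real (Suc n))" for n
    unfolding A_def using big[of n] by (simp add: le_imp_inverse_le)
  have A: "A \<longlonglongrightarrow> 0"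
    by (rule Lim_null_comparison[OF _ LIMSEQ_inverse_real_of_nat]) (use A_le in auto)
  have "(\<lambda>n. T n - t\<^sub>0) \<longlonglongrightarrow> 0"
    by (rule Lim_null_comparison[OF _ LIMSEQ_inverse_real_of_nat]) (use T(2) in auto)
  then have T_lim: "T \<longlonglongrightarrow> t\<^sub>0" by (simp add: Lim_null[symmetric])
  have "\<forall>n. A n *\<^sub>R V (T n) 0 \<in> sphere 0 1"
    using pos by (auto simp: A_def)
  then obtain l r where "l \<in> sphere 0 1" and r: "strict_mono r"
    and e: "((\<lambda>n. A n *\<^sub>R V (T n) 0) \<circ> r) \<longlonglongrightarrow> l"
    by (rule seq_compactE[OF compact_imp_seq_compact[OF compact_sphere]])
  then have l: "norm l = 1" by simp
  note sub = LIMSEQ_subseq_LIMSEQ[OF _ r, unfolded o_def]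
  have zero: "f' (x, t\<^sub>0) (l, 0) = 0" for x
  proof -
    have xT: "(\<lambda>n. (x, T n)) \<longlonglongrightarrow> (x, t\<^sub>0)"
      by (intro tendsto_intros T_lim)
    have f'_lim: "(\<lambda>n. f' (x, T n)) \<longlonglongrightarrow> f' (x, t\<^sub>0)"
      by (rule continuous_on_tendsto_compose[OF f'_cont xT]) (use assms T in auto)
    have f_lim: "(\<lambda>n. f x (T n)) \<longlonglongrightarrow> f x t\<^sub>0"
      using continuous_on_tendsto_compose[OF f_cont xT] assms T by auto
    have "(\<lambda>n. A n * (\<bar>f' (x, T n) (0, 1)\<bar> + real DIM('a) * L * f x (T n)))
        \<longlonglongrightarrow> 0 * (\<bar>f' (x, t\<^sub>0) (0, 1)\<bar> + real DIM('a) * L * f x t\<^sub>0)"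
      by (intro tendsto_intros A f'_lim f_lim)
    then have dom: "(\<lambda>n. A n * (\<bar>f' (x, T n) (0, 1)\<bar> + real DIM('a) * L * f x (T n))) \<longlonglongrightarrow> 0"
      by simp
    have "(\<lambda>n. f' (x, T n) (A n *\<^sub>R V (T n) x, 0)) \<longlonglongrightarrow> 0"
    proof (rule Lim_null_comparison[OF always_eventually dom], rule allI)
      fix n
      have "(A n *\<^sub>R V (T n) x, 0::real) = A n *\<^sub>R (V (T n) x, 0)" by simp
      then have "norm (f' (x, T n) (A n *\<^sub>R V (T n) x, 0)) = A n * \<bar>f' (x, T n) (V (T n) x, 0)\<bar>"
        using pos[of n] by (simp only: blinfun.scaleR_right) (simp add: A_def abs_mult)
      also have "\<dots> \<le> A n * (\<bar>f' (x, T n) (0, 1)\<bar> + real DIM('a) * L * f x (T n))"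
        using transport_estimate[OF T(1), of x n] by (intro mult_left_mono) (auto simp: A_def)
      finally show "norm (f' (x, T n) (A n *\<^sub>R V (T n) x, 0))
          \<le> A n * (\<bar>f' (x, T n) (0, 1)\<bar> + real DIM('a) * L * f x (T n))" .
    qed
    then have lim0: "(\<lambda>n. f' (x, T (r n)) (A (r n) *\<^sub>R V (T (r n)) x, 0)) \<longlonglongrightarrow> 0"
      by (rule sub)
    have "(\<lambda>n. A n * (L * norm x)) \<longlonglongrightarrow> 0 * (L * norm x)"
      by (intro tendsto_intros A)
    then have dom2: "(\<lambda>n. A n * (L * norm x)) \<longlonglongrightarrow> 0" by simp
    \<comment> \<open>The limit direction is the same at every \<open>x\<close>: replacing the
      velocity at 0 by that at \<open>x\<close> changes it by at most \<open>L * norm x\<close>,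
      which the factor \<open>A n\<close> sends to zero.\<close>
    have "(\<lambda>n. A n *\<^sub>R (V (T n) x - V (T n) 0)) \<longlonglongrightarrow> 0"
    proof (rule Lim_null_comparison[OF always_eventually dom2], rule allI)
      fix n
      show "norm (A n *\<^sub>R (V (T n) x - V (T n) 0)) \<le> A n * (L * norm x)"
        using lipschitz_onD[OF V_lipschitz[OF T(1)], of x 0 n] pos[of n]
        by (simp add: A_def dist_norm mult_left_mono)
    qed
    from tendsto_add[OF e[unfolded o_def] sub[OF this]]
    have "(\<lambda>n. A (r n) *\<^sub>R V (T (r n)) x) \<longlonglongrightarrow> l"
      by (simp add: algebra_simps)
    then have "(\<lambda>n. f' (x, T (r n)) (A (r n) *\<^sub>R V (T (r n)) x, 0)) \<longlonglongrightarrow> f' (x, t\<^sub>0) (l, 0)"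
      by (intro tendsto_intros sub[OF f'_lim])
    with lim0 show ?thesis by (rule LIMSEQ_unique[symmetric])
  qed
  obtain R where R: "\<And>x. norm x \<ge> R \<Longrightarrow> f x t\<^sub>0 = 0"
    using compactly_supported_bound[OF f_supp[OF assms]] by blast
  obtain x where x: "f x t\<^sub>0 \<noteq> 0" using f_nonzero[OF assms] by blast
  have "((\<lambda>s. f (x + s *\<^sub>R l) t\<^sub>0) has_real_derivative 0) (at s)" for s
    using space_deriv[OF assms, of x l s] by (simp add: zero)
  \<comment> \<open>As \<open>norm l = 1\<close>, a step of length
    \<open>\<bar>R\<bar> + norm x\<close> from \<open>x\<close> ends where the norm is at least
    \<open>R\<close> and \<open>f\<close> vanishes.\<close>
  then have "f (x + 0 *\<^sub>R l) t\<^sub>0 = f (x + (\<bar>R\<bar> + norm x) *\<^sub>R l) t\<^sub>0"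
    using DERIV_isconst_all[of "\<lambda>s. f (x + s *\<^sub>R l) t\<^sub>0" 0 "\<bar>R\<bar> + norm x"] by blast
  moreover have "norm (x + (\<bar>R\<bar> + norm x) *\<^sub>R l) \<ge> R"
    using norm_triangle_ineq2[of "(\<bar>R\<bar> + norm x) *\<^sub>R l" "- x"] l by (simp add: add.commute)
  ultimately show False using R x by simp
qed

text \<open>At a positive maximum of \<open>exp (- \<mu> t) f x t\<close> over the backward cone, the step
  \<open>(x + h V, t - h)\<close> along the characteristic stays in the cone and increases the function.\<close>

lemma vanishes_at_cone_tip:
  assumes s: "0 \<le> s" "s \<le> \<tau>" and "a \<ge> 0"
    and speed: "\<And>x t. s \<le> t \<Longrightarrow> t \<le> \<tau> \<Longrightarrow> norm (x - \<xi>) \<le> a * (\<tau> - t) \<Longrightarrow> norm (V t x) \<le> a"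
    and base: "\<And>x. norm (x - \<xi>) \<le> a * (\<tau> - s) \<Longrightarrow> f x s = 0"
  shows "f \<xi> \<tau> = 0"
proof (rule ccontr)
  assume "f \<xi> \<tau> \<noteq> 0"
  then have tip: "f \<xi> \<tau> > 0" using f_nonneg[of \<tau> \<xi>] s by simp
  \<comment> \<open>One more than the constant of \<open>transport_estimate\<close>: the derivative
    of the weighted function along the backward characteristic is then at least a positive multiple
    of \<open>f x t\<close>.\<close>
  define \<mu> where "\<mu> = real DIM('a) * L + 1"
  \<comment> \<open>The backward cone truncated at time \<open>s\<close>, written as a closed subset
    of a compact product so that \<open>g\<close> attains its maximum on it.\<close>
  define D where "D = (cball \<xi> (a * (\<tau> - s)) \<times> {s..\<tau>}) \<inter> {z. norm (fst z - \<xi>) \<le> a * (\<tau> - snd z)}"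
  define g where "g = (\<lambda>z. exp (- \<mu> * snd z) * f (fst z) (snd z))"
  have D_iff: "(x, t) \<in> D \<longleftrightarrow> s \<le> t \<and> t \<le> \<tau> \<and> norm (x - \<xi>) \<le> a * (\<tau> - t)" for x t
    using \<open>a \<ge> 0\<close> mult_left_mono[of "\<tau> - t" "\<tau> - s" a]
    by (auto simp: D_def dist_norm norm_minus_commute)
  have "compact D"
    unfolding D_def
    by (intro compact_Int_closed compact_Times closed_Collect_le continuous_intros) auto
  moreover have "(\<xi>, \<tau>) \<in> D" using s by (simp add: D_iff)
  moreover have "continuous_on D (\<lambda>z. (\<lambda>(x, t). f x t) z)"
    using s by (intro continuous_on_subset[OF f_cont]) (auto simp: D_def)
  then have "continuous_on D g"
    unfolding g_def by (intro continuous_intros) (simp add: case_prod_unfold)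
  ultimately obtain z where "z \<in> D" and z: "\<And>y. y \<in> D \<Longrightarrow> g y \<le> g z"
    using continuous_attains_sup[of D g] by blast
  then obtain x t where xt: "(x, t) \<in> D" and max: "\<And>y. y \<in> D \<Longrightarrow> g y \<le> g (x, t)"
    by (metis surj_pair)
  have "0 < g (\<xi>, \<tau>)" using tip by (simp add: g_def)
  also have "\<dots> \<le> g (x, t)" by (rule max) fact
  finally have f_pos: "f x t > 0" by (simp add: g_def zero_less_mult_iff)
  then have "t \<noteq> s" using base xt by (auto simp: D_iff)
  then have t: "s < t" "t \<le> \<tau>" using xt by (auto simp: D_iff)
  define v where "v = V t x"
  have v: "norm v \<le> a" unfolding v_def using xt by (intro speed) (auto simp: D_iff)
  \<comment> \<open>Since \<open>t > s \<ge> 0\<close>, the derivative within the half-space is an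
    ordinary derivative and the chain rule applies along the characteristic.\<close>
  have "(x, t) \<in> interior (UNIV \<times> {0..})"
    using t s by (simp add: interior_Times)
  then have "((\<lambda>(x, t). f x t) has_derivative f' (x, t)) (at (x, t))"
    using f_deriv[of t x] t s by (simp only: at_within_interior)
  then have "((\<lambda>(x, t). f x t) has_derivative f' (x, t)) (at (x + 0 *\<^sub>R v, t - 0))" by simp
  moreover have "((\<lambda>h. (x + h *\<^sub>R v, t - h)) has_derivative (\<lambda>h. h *\<^sub>R (v, - 1))) (at 0)"
    by (auto intro!: derivative_eq_intros)
  ultimately have "((\<lambda>h. (\<lambda>(x, t). f x t) (x + h *\<^sub>R v, t - h)) has_derivative
      (\<lambda>h. f' (x, t) (h *\<^sub>R (v, - 1)))) (at 0)"
    by (rule has_derivative_compose[rotated])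
  then have "((\<lambda>h. f (x + h *\<^sub>R v) (t - h)) has_real_derivative f' (x, t) (v, - 1)) (at 0)"
    by (simp only: has_field_derivative_def blinfun.scaleR_right split_conv real_scaleR_def mult_commute_abs)
  then have deriv: "((\<lambda>h. g (x + h *\<^sub>R v, t - h)) has_real_derivative
      exp (- \<mu> * t) * (\<mu> * f x t + f' (x, t) (v, - 1))) (at 0)"
    unfolding g_def by (auto intro!: derivative_eq_intros simp: algebra_simps)
  have "(v, - 1) = (v, 0) - (0, 1::real)" by simp
  then have "f' (x, t) (v, - 1) = f' (x, t) (v, 0) - f' (x, t) (0, 1)"
    by (simp only: blinfun.diff_right)
  then have "\<mu> * f x t + f' (x, t) (v, - 1) > 0"
    using transport_estimate[of t x] s t f_pos by (auto simp: \<mu>_def v_def algebra_simps abs_le_iff)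
  then have "exp (- \<mu> * t) * (\<mu> * f x t + f' (x, t) (v, - 1)) > 0" by simp
  from DERIV_pos_inc_right[OF deriv this] obtain d where d: "d > 0"
    "\<And>h. 0 < h \<Longrightarrow> h < d \<Longrightarrow> g (x, t) < g (x + h *\<^sub>R v, t - h)"
    by auto
  \<comment> \<open>\<open>d / 2\<close> keeps the step inside the range of strict increase, and
    \<open>t - s\<close> keeps the new time above the base of the cone.\<close>
  define h where "h = min (d / 2) (t - s)"
  have h: "0 < h" "h < d" "h \<le> t - s" using d t by (auto simp: h_def)
  have "norm (x + h *\<^sub>R v - \<xi>) \<le> norm (x - \<xi>) + h * norm v"
    using norm_triangle_ineq[of "x - \<xi>" "h *\<^sub>R v"] h by (simp add: algebra_simps)
  also have "\<dots> \<le> a * (\<tau> - t) + h * a"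
    using xt v h by (intro add_mono mult_left_mono) (auto simp: D_iff)
  also have "\<dots> = a * (\<tau> - (t - h))" by (simp add: algebra_simps)
  finally have "(x + h *\<^sub>R v, t - h) \<in> D" using h t by (auto simp: D_iff)
  then show False using max d(2)[OF h(1,2)] by force
qed

text \<open>For a distant point \<open>\<xi>\<close> a backward cone is used whose slope
  \<open>a\<close> bounds the speed on the ball of radius \<open>2 * norm \<xi>\<close>. This slope
  grows linearly in \<open>norm \<xi>\<close>, so a time span small against \<open>1 / L\<close>
  keeps the base of the cone within \<open>norm \<xi> / 2\<close> of \<open>\<xi>\<close>, outside
  the support at the base time.\<close>

lemma locally_uniform_support:
  assumes "t\<^sub>0 \<ge> 0"
  obtains \<delta> R where "\<delta> > 0" "R > 0"
    "\<And>t x. t \<ge> 0 \<Longrightarrow> \<bar>t - t\<^sub>0\<bar> \<le> \<delta> \<Longrightarrow> norm x \<ge> R \<Longrightarrow> f x t = 0"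
proof -
  obtain \<delta>\<^sub>0 C where "\<delta>\<^sub>0 > 0" and C: "\<And>t. t \<ge> 0 \<Longrightarrow> \<bar>t - t\<^sub>0\<bar> \<le> \<delta>\<^sub>0 \<Longrightarrow> norm (V t 0) \<le> C"
    using V_locally_bounded[OF assms] by blast
  have "C \<ge> 0" using order_trans[OF norm_ge_zero C[OF assms]] \<open>\<delta>\<^sub>0 > 0\<close> by simp
  \<comment> \<open>The times considered span at most \<open>2 * \<delta>\<close>, and the part
    \<open>2 * L * norm \<xi>\<close> of the speed then contributes
    \<open>4 * L * \<delta> * norm \<xi>\<close>, at most a quarter of \<open>norm \<xi>\<close>.
    Using \<open>L + 1\<close> covers \<open>L = 0\<close>.\<close>
  define \<delta> where "\<delta> = min \<delta>\<^sub>0 (1 / (16 * (L + 1)))"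
  have \<delta>: "\<delta> > 0" "\<delta> \<le> \<delta>\<^sub>0" using \<open>\<delta>\<^sub>0 > 0\<close> L_nonneg by (auto simp: \<delta>_def)
  have "\<delta> * (16 * (L + 1)) \<le> 1"
    using L_nonneg by (simp add: \<delta>_def pos_le_divide_eq[symmetric])
  then have L\<delta>: "4 * L * \<delta> \<le> 1 / 4" using \<delta>(1) by (simp add: algebra_simps)
  define s where "s = max 0 (t\<^sub>0 - \<delta>)"
  obtain R\<^sub>0 where R\<^sub>0: "R\<^sub>0 > 0" "\<And>x. norm x \<ge> R\<^sub>0 \<Longrightarrow> f x s = 0"
    using compactly_supported_bound[OF f_supp[of s]] by (auto simp: s_def)
  \<comment> \<open>The term \<open>8 * \<delta> * C\<close> makes the contribution of
    \<open>C\<close> to the base radius at most \<open>norm \<xi> / 4\<close>; the term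
    \<open>2 * R\<^sub>0\<close> ensures \<open>norm \<xi> / 2 \<ge> R\<^sub>0\<close>.\<close>
  define R where "R = 2 * R\<^sub>0 + 8 * \<delta> * C"
  have "f \<xi> \<tau> = 0" if \<tau>: "\<tau> \<ge> 0" "\<bar>\<tau> - t\<^sub>0\<bar> \<le> \<delta>" and \<xi>: "norm \<xi> \<ge> R" for \<tau> \<xi>
  proof -
    define a where "a = C + 2 * L * norm \<xi>"
    have "a \<ge> 0" using \<open>C \<ge> 0\<close> L_nonneg by (simp add: a_def)
    have "\<tau> - s \<le> 2 * \<delta>" and s: "0 \<le> s" "s \<le> \<tau>" using \<tau> by (auto simp: s_def)
    then have "a * (\<tau> - s) \<le> a * (2 * \<delta>)" using \<open>a \<ge> 0\<close> by (intro mult_left_mono)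
    also have "\<dots> = 2 * \<delta> * C + (4 * L * \<delta>) * norm \<xi>" by (simp add: a_def algebra_simps)
    also have "\<dots> \<le> norm \<xi> / 4 + 1 / 4 * norm \<xi>"
      using \<xi> R\<^sub>0(1) L\<delta> by (intro add_mono mult_right_mono) (auto simp: R_def)
    finally have half: "a * (\<tau> - s) \<le> norm \<xi> / 2" by simp
    show ?thesis
    proof (rule vanishes_at_cone_tip[OF s \<open>a \<ge> 0\<close>])
      fix x t assume t: "s \<le> t" "t \<le> \<tau>" and x: "norm (x - \<xi>) \<le> a * (\<tau> - t)"
      have "a * (\<tau> - t) \<le> a * (\<tau> - s)" using t \<open>a \<ge> 0\<close> by (intro mult_left_mono) auto
      then have "norm x \<le> 2 * norm \<xi>"
        using x half norm_triangle_sub[of x \<xi>] norm_ge_zero[of \<xi>] by linarith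
      then have "L * norm x \<le> 2 * L * norm \<xi>"
        using mult_left_mono[OF _ L_nonneg] by fastforce
      moreover have "t \<ge> 0" "\<bar>t - t\<^sub>0\<bar> \<le> \<delta>\<^sub>0" using t \<tau> \<delta> by (auto simp: s_def)
      ultimately show "norm (V t x) \<le> a"
        using V_growth[of t x] C[of t] by (simp add: a_def)
    next
      fix x assume "norm (x - \<xi>) \<le> a * (\<tau> - s)"
      then have "norm (x - \<xi>) \<le> norm \<xi> / 2" using half by simp
      then have "norm x \<ge> norm \<xi> / 2"
        using norm_triangle_ineq2[of \<xi> x] by (simp add: norm_minus_commute)
      moreover have "norm \<xi> / 2 \<ge> R\<^sub>0"
        using \<xi> \<open>C \<ge> 0\<close> \<delta> unfolding R_def by (smt (verit) field_sum_of_halves mult_nonneg_nonneg)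
      ultimately show "f x s = 0" by (intro R\<^sub>0) simp
    qed
  qed
  moreover have "R > 0" using R\<^sub>0 \<delta> \<open>C \<ge> 0\<close> by (simp add: R_def add_pos_nonneg)
  ultimately show ?thesis using that \<delta> by blast
qed

section \<open>Energy dissipation by integration by parts\<close>

text \<open>A zero of the nonnegative function \<open>f\<close> is a minimum along every line in
  space.\<close>

lemma space_deriv_eq_0:
  assumes "t \<ge> 0" "f x t = 0"
  shows "f' (x, t) (v, 0) = 0"
proof (rule DERIV_local_min)
  show "((\<lambda>s. f (x + s *\<^sub>R v) t) has_real_derivative f' (x, t) (v, 0)) (at 0)"
    using space_deriv[OF assms(1), of x v 0] by simp
  show "\<forall>s. \<bar>0 - s\<bar> < 1 \<longrightarrow> f (x + 0 *\<^sub>R v) t \<le> f (x + s *\<^sub>R v) t"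
    using assms f_nonneg by simp
qed simp

text \<open>For each basis vector \<open>b\<close> the derivative of
  \<open>K f (V \<bullet> b)\<close> along \<open>b\<close> integrates to zero. The product rule
  treats \<open>f (V \<bullet> b)\<close> as a single factor, since \<open>V \<bullet> b\<close>
  alone need not be differentiable. Summing over \<open>b\<close> gives
  \<open>f * norm V ^ 2\<close> plus \<open>K\<close> times the divergence of the flux, which is the
  time derivative.\<close>

lemma dissipation_identity:
  assumes "t \<ge> 0" and K: "\<And>y. GDERIV K y :> V t y"
  shows "(LINT x|lebesgue. K x * f' (x, t) (0, 1)) = - (LINT x|lebesgue. f x t * (norm (V t x))\<^sup>2)"
proof -
  define D where "D = (\<lambda>b y. deriv (\<lambda>s. (f (y + s *\<^sub>R b) t *\<^sub>R V t (y + s *\<^sub>R b)) \<bullet> b) 0)"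
  define G' where "G' = (\<lambda>b x. (V t x \<bullet> b) * (f x t * (V t x \<bullet> b)) + K x * D b x)"
  have K_cont: "continuous_on UNIV K"
    using K by (intro continuous_at_imp_continuous_on) (auto simp: gderiv_def dest: has_derivative_continuous)
  obtain R where R: "\<And>x. norm x \<ge> R \<Longrightarrow> f x t = 0"
    using compactly_supported_bound[OF f_supp[OF assms(1)]] by blast
  note slice_cont = f_slice_cont[OF assms(1)] f'_slice_cont[OF assms(1)] V_cont[OF assms(1)]
  have G': "integrable lebesgue (G' b)" "(LINT x|lebesgue. G' b x) = 0" if b: "b \<in> Basis" for b
  proof -
    let ?G = "\<lambda>x. K x * (f x t * (V t x \<bullet> b))"
    have cont: "continuous_on UNIV ?G"
      by (intro continuous_intros K_cont slice_cont)
    have supp: "compactly_supported ?G"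
      by (intro compactly_supported_mult f_supp assms)
    have deriv: "((\<lambda>s. ?G (x + s *\<^sub>R b)) has_real_derivative G' b x) (at 0)" for x
    proof -
      have "(\<lambda>s. (f (x + s *\<^sub>R b) t *\<^sub>R V t (x + s *\<^sub>R b)) \<bullet> b) differentiable (at 0)"
        using div_exists[OF assms(1), of x] b by (auto simp: divergence_exists_def)
      then have "((\<lambda>s. (f (x + s *\<^sub>R b) t *\<^sub>R V t (x + s *\<^sub>R b)) \<bullet> b) has_real_derivative D b x) (at 0)"
        unfolding D_def using DERIV_deriv_iff_real_differentiable by blast
      then have "((\<lambda>s. f (x + s *\<^sub>R b) t * (V t (x + s *\<^sub>R b) \<bullet> b)) has_real_derivative D b x) (at 0)"
        by simp
      moreover have "((\<lambda>s. K (x + s *\<^sub>R b)) has_real_derivative (b \<bullet> V t x)) (at 0)"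
        using GDERIV_imp_DERIV_line[of K x 0 b] K[of x] by simp
      ultimately show ?thesis
        using DERIV_mult[of "\<lambda>s. K (x + s *\<^sub>R b)" "b \<bullet> V t x" 0 UNIV
            "\<lambda>s. f (x + s *\<^sub>R b) t * (V t (x + s *\<^sub>R b) \<bullet> b)" "D b x"]
        by (simp add: G'_def inner_commute mult.commute)
    qed
    \<comment> \<open>The flux derivative \<open>D b\<close> is not known to be continuous. It is
      replaced by the bound of \<open>flux_deriv_estimate\<close>, so that the majorant
      \<open>m\<close> is continuous and vanishes where \<open>f\<close> does.\<close>
    define m where "m = (\<lambda>x. \<bar>(V t x \<bullet> b) * (f x t * (V t x \<bullet> b))\<bar>
        + \<bar>K x\<bar> * (L * f x t + \<bar>f' (x, t) (b, 0) * (V t x \<bullet> b)\<bar>))"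
    have G'_le: "\<bar>G' b x\<bar> \<le> m x" for x
    proof -
      have "\<bar>D b x\<bar> \<le> L * f x t + \<bar>f' (x, t) (b, 0) * (V t x \<bullet> b)\<bar>"
        using flux_deriv_estimate[OF assms(1) b, of x] unfolding D_def by linarith
      then have "\<bar>K x * D b x\<bar> \<le> \<bar>K x\<bar> * (L * f x t + \<bar>f' (x, t) (b, 0) * (V t x \<bullet> b)\<bar>)"
        unfolding abs_mult by (intro mult_left_mono) (auto simp: abs_mult)
      then show ?thesis
        unfolding G'_def m_def using abs_triangle_ineq[of "(V t x \<bullet> b) * (f x t * (V t x \<bullet> b))" "K x * D b x"]
        by linarith
    qed
    have "continuous_on UNIV m"
      unfolding m_def by (intro continuous_intros K_cont slice_cont)
    then have "bounded (m ` cball 0 R)"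
      by (intro compact_imp_bounded compact_continuous_image) (auto intro: continuous_on_subset)
    then obtain M where M: "\<forall>x\<in>cball 0 R. \<bar>m x\<bar> \<le> M" unfolding bounded_iff by auto
    have bound: "\<bar>G' b x\<bar> \<le> \<bar>M\<bar>" for x
    proof (cases "norm x \<le> R")
      case True
      then have "\<bar>m x\<bar> \<le> M" using M by simp
      then show ?thesis using G'_le[of x] by linarith
    next
      case False
      then have "f x t = 0" by (intro R) simp
      then have "m x = 0" using space_deriv_eq_0[OF assms(1)] by (simp add: m_def)
      then show ?thesis using G'_le[of x] by linarith
    qed
    have "norm b = 1" using b by simp
    from integral_directional_derivative[OF cont supp this deriv bound]
    show "integrable lebesgue (G' b)" "(LINT x|lebesgue. G' b x) = 0" .
  qed
  have sum: "(\<Sum>b\<in>Basis. G' b x) = f x t * (norm (V t x))\<^sup>2 + K x * f' (x, t) (0, 1)" for x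
  proof -
    have "(norm (V t x))\<^sup>2 = (\<Sum>b\<in>Basis. (V t x \<bullet> b) * (V t x \<bullet> b))"
      by (simp add: power2_norm_eq_inner euclidean_inner[of "V t x" "V t x"])
    then show ?thesis
      unfolding G'_def time_deriv_eq_divergence[OF assms(1)] divergence_def D_def
      by (simp add: sum.distrib sum_distrib_left algebra_simps)
  qed
  have int1: "integrable lebesgue (\<lambda>x. f x t * (norm (V t x))\<^sup>2)"
    by (intro integrable_continuous_compactly_supported continuous_intros slice_cont
        compactly_supported_mult(1) f_supp assms)
  have "integrable lebesgue (\<lambda>x. f x t * (norm (V t x))\<^sup>2 + K x * f' (x, t) (0, 1))"
    unfolding sum[symmetric] by (intro Bochner_Integration.integrable_sum G')
  from Bochner_Integration.integrable_diff[OF this int1]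
  have int2: "integrable lebesgue (\<lambda>x. K x * f' (x, t) (0, 1))" by simp
  have "(LINT x|lebesgue. f x t * (norm (V t x))\<^sup>2) + (LINT x|lebesgue. K x * f' (x, t) (0, 1))
      = (LINT x|lebesgue. (\<Sum>b\<in>Basis. G' b x))"
    unfolding sum by (rule Bochner_Integration.integral_add[OF int1 int2, symmetric])
  also have "\<dots> = 0" using G' by (simp add: Bochner_Integration.integral_sum)
  finally show ?thesis by simp
qed

section \<open>Differentiation of the energy in time\<close>

text \<open>By \<open>energy_difference\<close> the difference quotient is a linear term minus half
  of \<open>Q s / (s - t)\<close>. The locally uniform support supplies a dominating function for
  the linear term and makes \<open>Q\<close> of order \<open>(s - t)^2\<close>.\<close>

lemma energy_has_derivative:
  assumes t: "t \<ge> 0"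
    and w: "integrable lebesgue w" "compactly_supported w" and \<phi>: "continuous_on UNIV \<phi>"
    and \<psi>: "continuous_on UNIV \<psi>" "\<And>x. \<psi> (- x) = \<psi> x"
  shows "((\<lambda>s. energy w \<phi> \<psi> (\<lambda>x. f x s)) has_real_derivative
    (LINT x|lebesgue. potential w \<phi> \<psi> (\<lambda>x. f x t) x * f' (x, t) (0, 1))) (at t within {0..})"
proof -
  define K where "K = potential w \<phi> \<psi> (\<lambda>x. f x t)"
  note ft = f_slice_cont[OF t] f_supp[OF t]
  have K_cont: "continuous_on UNIV K"
    unfolding K_def
    using potential_eq[OF w \<phi> integrable_continuous_compactly_supported(2)[OF ft] ft(2) \<psi>(1)]
      continuous_on_convolution[OF w \<phi>]
      continuous_on_convolution[OF integrable_continuous_compactly_supported(2)[OF ft] ft(2) \<psi>(1)]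
    by (simp add: continuous_on_diff)
  obtain \<delta> R where "\<delta> > 0" "R > 0"
    and R: "\<And>s x. s \<ge> 0 \<Longrightarrow> \<bar>s - t\<bar> \<le> \<delta> \<Longrightarrow> norm x \<ge> R \<Longrightarrow> f x s = 0"
    using locally_uniform_support[OF t] by metis
  \<comment> \<open>A neighbourhood of \<open>t\<close> in the half-line: compact, to bound the time
    derivative, and convex, for the mean value inequality.\<close>
  define I where "I = {0..} \<inter> cball t \<delta>"
  have I: "s \<in> I \<longleftrightarrow> s \<ge> 0 \<and> \<bar>s - t\<bar> \<le> \<delta>" for s
    by (auto simp: I_def dist_real_def)
  have within_eq: "at t within {0..} = at t within I"
    using \<open>\<delta> > 0\<close> by (intro at_within_nhd[of t "ball t \<delta>"]) (auto simp: I_def)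
  have "compact I" "convex I" unfolding I_def
    by (auto intro!: closed_Int_compact convex_Int)
  have "bounded ((\<lambda>z. f' z (0, 1)) ` (cball 0 R \<times> I))"
    using \<open>compact I\<close> by (intro compact_imp_bounded compact_continuous_image compact_Times
        continuous_on_subset[OF f'_apply_cont]) (auto simp: I)
  then obtain M where M: "\<forall>z\<in>cball 0 R \<times> I. \<bar>f' z (0, 1)\<bar> \<le> M"
    unfolding bounded_iff by auto
  have "t \<in> I" using t \<open>\<delta> > 0\<close> by (simp add: I)
  then have "(0, t) \<in> cball 0 R \<times> I" using \<open>R > 0\<close> by simp
  then have "M \<ge> 0" using M abs_ge_zero order_trans by blast
  define d where "d = (\<lambda>s x. f x s - f x t)"
  have d_bound: "\<bar>d s x\<bar> \<le> M * \<bar>s - t\<bar>" if s: "s \<in> I" and x: "norm x \<le> R" for s x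
  proof -
    have "norm (f x s - f x t) \<le> M * norm (s - t)"
    proof (rule field_differentiable_bound[OF \<open>convex I\<close>])
      show "(f x has_real_derivative f' (x, z) (0, 1)) (at z within I)" if "z \<in> I" for z
        using that by (intro DERIV_subset[OF time_deriv]) (auto simp: I)
      show "norm (f' (x, z) (0, 1)) \<le> M" if "z \<in> I" for z
        using M that x by auto
    qed (use s \<open>t \<in> I\<close> in auto)
    then show ?thesis by (simp add: d_def)
  qed
  have d_zero: "d s x = 0" if "s \<in> I" "norm x \<ge> R" for s x
    using that R t \<open>\<delta> > 0\<close> by (simp add: d_def I)
  define vol where "vol = measure lebesgue (cball 0 R :: 'a set)"
  \<comment> \<open>Differences of two points of the ball of radius \<open>R\<close> have norm at
    most \<open>2 * R\<close>.\<close>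
  have "bounded (\<psi> ` cball 0 (2 * R))"
    by (intro compact_imp_bounded compact_continuous_image continuous_on_subset[OF \<psi>(1)]) auto
  then obtain P where P: "\<forall>x\<in>cball 0 (2 * R). \<bar>\<psi> x\<bar> \<le> P"
    unfolding bounded_iff by auto
  have "0 \<in> cball (0::'a) (2 * R)" using \<open>R > 0\<close> by simp
  then have "P \<ge> 0" using P abs_ge_zero order_trans by blast
  define Q where "Q = (\<lambda>s. LINT x|lebesgue. d s x * convolution (d s) \<psi> x)"
  \<comment> \<open>Each of the two factors \<open>d s\<close> contributes
    \<open>M * \<bar>s - t\<bar>\<close>, and each of the two integrations over the ball contributes
    \<open>vol\<close>.\<close>
  have Q_bound: "\<bar>Q s\<bar> \<le> (M\<^sup>2 * P * vol\<^sup>2) * (s - t)\<^sup>2" if s: "s \<in> I" for s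
  proof -
    let ?S = "M * \<bar>s - t\<bar>"
    have S: "?S \<ge> 0" using \<open>M \<ge> 0\<close> by simp
    have vol: "vol \<ge> 0" by (simp add: vol_def)
    have conv: "\<bar>convolution (d s) \<psi> x\<bar> \<le> ?S * P * vol" if x: "norm x \<le> R" for x
      unfolding convolution_def vol_def
    proof (rule abs_integral_le_cball)
      fix y :: 'a assume y: "norm y \<le> R"
      have "\<bar>\<psi> (x - y)\<bar> \<le> P" using P x y norm_triangle_ineq4[of x y] by simp
      then show "\<bar>d s y * \<psi> (x - y)\<bar> \<le> ?S * P"
        unfolding abs_mult by (intro mult_mono d_bound s y S) auto
    qed (use S \<open>P \<ge> 0\<close> s d_zero in auto)
    have "\<bar>Q s\<bar> \<le> (?S * (?S * P * vol)) * vol"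
      unfolding Q_def vol_def
    proof (rule abs_integral_le_cball)
      fix x :: 'a assume "norm x \<le> R"
      then show "\<bar>d s x * convolution (d s) \<psi> x\<bar> \<le> ?S * (?S * P * measure lebesgue (cball (0::'a) R))"
        using d_bound[OF s] conv S unfolding abs_mult vol_def by (intro mult_mono) auto
    qed (use S \<open>P \<ge> 0\<close> vol s d_zero in \<open>auto simp: vol_def\<close>)
    also have "\<dots> = (M\<^sup>2 * P * vol\<^sup>2) * (s - t)\<^sup>2"
      by (simp add: power2_eq_square algebra_simps flip: abs_mult_self_eq[of "s - t"])
    finally show ?thesis .
  qed
  have quotient: "(energy w \<phi> \<psi> (\<lambda>x. f x s) - energy w \<phi> \<psi> (\<lambda>x. f x t)) / (s - t)
      = (LINT x|lebesgue. K x * (d s x / (s - t))) - 1 / 2 * (Q s / (s - t))" if "s \<in> I" for s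
  proof -
    have "s \<ge> 0" using that by (simp add: I)
    from energy_difference[OF w \<phi> \<psi> f_slice_cont[OF this] f_supp[OF this] ft]
    have "energy w \<phi> \<psi> (\<lambda>x. f x s) - energy w \<phi> \<psi> (\<lambda>x. f x t)
        = (LINT x|lebesgue. K x * d s x) - 1 / 2 * Q s"
      by (simp only: K_def Q_def d_def)
    then show ?thesis by (simp add: diff_divide_distrib)
  qed
  show ?thesis
    unfolding has_field_derivative_iff within_eq tendsto_at_iff_sequentially K_def[symmetric]
  proof (intro allI impI)
    fix X assume X: "\<forall>i. X i \<in> I - {t}" and X_lim: "X \<longlonglongrightarrow> t"
    have X_I: "X i \<in> I" and X_ne: "X i \<noteq> t" for i using X by auto
    \<comment> \<open>The potential need not be integrable on the whole space, so the dominating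
      function is cut off to the ball containing all supports for times in \<open>I\<close>.\<close>
    have K_int: "integrable lebesgue (\<lambda>x. M * \<bar>K x * indicator (cball 0 R) x\<bar>)"
    proof -
      have "integrable lborel (\<lambda>x. indicator (cball 0 R) x *\<^sub>R K x)"
        by (intro borel_integrable_compact continuous_on_subset[OF K_cont]) auto
      then have "integrable lebesgue (\<lambda>x. indicator (cball 0 R) x *\<^sub>R K x)"
        by (simp add: integrable_completion)
      then show ?thesis by (intro integrable_mult_right integrable_abs) (simp add: mult.commute)
    qed
    have lin: "(\<lambda>n. LINT x|lebesgue. K x * (d (X n) x / (X n - t)))
        \<longlonglongrightarrow> (LINT x|lebesgue. K x * f' (x, t) (0, 1))"
    proof (rule integral_dominated_convergence[OF _ _ K_int AE_I2 AE_I2])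
      have cont_meas: "u \<in> borel_measurable lebesgue" if "continuous_on UNIV u" for u :: "'a \<Rightarrow> real"
        using borel_measurable_continuous_onI[OF that] by (simp add: measurable_completion)
      show "(\<lambda>x. K x * f' (x, t) (0, 1)) \<in> borel_measurable lebesgue"
        by (intro cont_meas continuous_intros K_cont f'_slice_cont t)
      show "(\<lambda>x. K x * (d (X n) x / (X n - t))) \<in> borel_measurable lebesgue" for n
        unfolding d_def using X_I[of n] X_ne[of n]
        by (intro cont_meas continuous_intros K_cont f_slice_cont t) (auto simp: I)
      show "(\<lambda>n. K x * (d (X n) x / (X n - t))) \<longlonglongrightarrow> K x * f' (x, t) (0, 1)" for x
      proof -
        have "\<forall>i. X i \<in> {0..} - {t}" using X_I X_ne by (auto simp: I)
        then have "(\<lambda>n. d (X n) x / (X n - t)) \<longlonglongrightarrow> f' (x, t) (0, 1)"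
          using time_deriv[OF t, of x] X_lim
          unfolding has_field_derivative_iff tendsto_at_iff_sequentially o_def d_def by blast
        then show ?thesis by (intro tendsto_intros)
      qed
      show "norm (K x * (d (X n) x / (X n - t))) \<le> M * \<bar>K x * indicator (cball 0 R) x\<bar>" for n x
      proof (cases "norm x \<le> R")
        case True
        have "\<bar>d (X n) x\<bar> / \<bar>X n - t\<bar> \<le> M"
          using d_bound[OF X_I True, of n] X_ne[of n] by (simp add: divide_le_eq)
        then have "\<bar>K x\<bar> * (\<bar>d (X n) x\<bar> / \<bar>X n - t\<bar>) \<le> \<bar>K x\<bar> * M"
          by (intro mult_left_mono) auto
        then show ?thesis using True by (simp add: abs_mult abs_divide mult.commute)
      next
        case False
        then show ?thesis using d_zero[OF X_I] by simp
      qed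
    qed
    have "(\<lambda>n. (M\<^sup>2 * P * vol\<^sup>2) * \<bar>X n - t\<bar>) \<longlonglongrightarrow> (M\<^sup>2 * P * vol\<^sup>2) * \<bar>t - t\<bar>"
      by (intro tendsto_intros X_lim)
    then have dom: "(\<lambda>n. (M\<^sup>2 * P * vol\<^sup>2) * \<bar>X n - t\<bar>) \<longlonglongrightarrow> 0" by simp
    have "(\<lambda>n. Q (X n) / (X n - t)) \<longlonglongrightarrow> 0"
    proof (rule Lim_null_comparison[OF always_eventually dom], rule allI)
      fix n
      have "\<bar>Q (X n)\<bar> \<le> ((M\<^sup>2 * P * vol\<^sup>2) * \<bar>X n - t\<bar>) * \<bar>X n - t\<bar>"
        using Q_bound[OF X_I[of n]] by (simp add: power2_eq_square mult.assoc)
      then show "norm (Q (X n) / (X n - t)) \<le> (M\<^sup>2 * P * vol\<^sup>2) * \<bar>X n - t\<bar>"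
        using X_ne[of n] by (simp add: abs_divide divide_le_eq)
    qed
    from tendsto_diff[OF lin tendsto_mult[OF tendsto_const[of "1 / 2"] this]]
    show "((\<lambda>s. (energy w \<phi> \<psi> (\<lambda>x. f x s) - energy w \<phi> \<psi> (\<lambda>x. f x t)) / (s - t)) \<circ> X)
        \<longlonglongrightarrow> (LINT x|lebesgue. K x * f' (x, t) (0, 1))"
      by (simp add: o_def quotient[OF X_I])
  qed
qed

end

section \<open>Decay of the energy for the nonlocal equation\<close>

text \<open>Differentiability of the kernels accompanies the Lipschitz conditions because
  \<open>gradient\<close> is a definite description. The conclusion includes existence of the
  derivative, which is one-sided at \<open>t = 0\<close> and two-sided afterwards.\<close>

theorem lemma2:
  fixes w \<phi> \<psi> f\<^sub>0 :: "'a::euclidean_space \<Rightarrow> real"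
    and f :: "'a \<Rightarrow> real \<Rightarrow> real"
  assumes "\<And>x. w x \<ge> 0"
    and "integrable lebesgue w"
    and "compactly_supported w"
    and "(LINT x|lebesgue. w x) = 1"
    and "radial \<phi>"
    and "\<phi> differentiable_on UNIV"
    and "\<exists>L. L-lipschitz_on UNIV (gradient \<phi>)"
    and "radial \<psi>"
    and "\<psi> differentiable_on UNIV"
    and "\<exists>L. L-lipschitz_on UNIV (gradient \<psi>)"
    and "C1_on UNIV f\<^sub>0"
    and "compactly_supported f\<^sub>0"
    and "\<And>x. f\<^sub>0 x \<ge> 0"
    and "(LINT x|lebesgue. f\<^sub>0 x) = 1"
    and "classical_solution w \<phi> \<psi> f\<^sub>0 f"
    and "\<And>x t. t \<ge> 0 \<Longrightarrow> f x t \<ge> 0"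
    and "\<And>t. t \<ge> 0 \<Longrightarrow> compactly_supported (\<lambda>x. f x t)"
    and "\<And>t. t \<ge> 0 \<Longrightarrow> (LINT x|lebesgue. f x t) = 1"
  shows "\<forall>t\<ge>0. \<exists>D. ((\<lambda>s. energy w \<phi> \<psi> (\<lambda>x. f x s)) has_real_derivative D) (at t within {0..})
           \<and> D \<le> 0"
proof -
  obtain A B where A: "A-lipschitz_on UNIV (gradient \<phi>)" and B: "B-lipschitz_on UNIV (gradient \<psi>)"
    using assms(7,10) by blast
  define K where "K = (\<lambda>t. potential w \<phi> \<psi> (\<lambda>x. f x t))"
  have C1: "C1_on (UNIV \<times> {0..}) (\<lambda>(x, t). f x t)"
    and K_diff: "\<And>t. t \<ge> 0 \<Longrightarrow> K t differentiable_on UNIV"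
    and div: "\<And>t y. t \<ge> 0 \<Longrightarrow> divergence_exists (\<lambda>y. f y t *\<^sub>R gradient (K t) y) y"
    and evol: "\<And>t y. t \<ge> 0 \<Longrightarrow> ((\<lambda>s. f y s) has_real_derivative
        divergence (\<lambda>y. f y t *\<^sub>R gradient (K t) y) y) (at t within {0..})"
    using assms(15) unfolding classical_solution_def Let_def K_def by blast+
  obtain f' :: "'a \<times> real \<Rightarrow> ('a \<times> real) \<Rightarrow>\<^sub>L real" where f':
    "\<And>z. z \<in> UNIV \<times> {0..} \<Longrightarrow> ((\<lambda>(x, t). f x t) has_derivative f' z) (at z within UNIV \<times> {0..})"
    "continuous_on (UNIV \<times> {0..}) f'"
    using C1 unfolding C1_on_def by blast
  \<comment> \<open>Radial functions are even; this is the symmetry that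
    \<open>energy_difference\<close> relies on.\<close>
  have \<psi>_even: "\<psi> (- x) = \<psi> x" for x
    using assms(8) unfolding radial_def by (metis norm_minus_cancel)
  \<comment> \<open>The integral of a non-integrable function is 0 by convention, so the value 1
    implies integrability.\<close>
  have f_int: "integrable lebesgue (\<lambda>x. f x t)" if "t \<ge> 0" for t
    using assms(18)[OF that] not_integrable_integral_eq by fastforce
  interpret transport_solution f f' "\<lambda>t. gradient (K t)" "A + B"
  proof
    fix t :: real and x :: 'a assume t: "t \<ge> 0"
    show "((\<lambda>(x, t). f x t) has_derivative f' (x, t)) (at (x, t) within UNIV \<times> {0..})"
      using t by (intro f') simp
    show "(A + B)-lipschitz_on UNIV (gradient (K t))"
      unfolding K_def
      by (rule lipschitz_gradient_potential[OF assms(2,3,1,4,6) A f_int[OF t] assms(17)[OF t]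
            assms(16)[OF t] assms(18)[OF t] assms(9) B K_diff[OF t, unfolded K_def]])
    show "\<exists>x. f x t \<noteq> 0"
    proof (rule ccontr)
      assume "\<not> ?thesis"
      then have "(\<lambda>x. f x t) = (\<lambda>x. 0)" by auto
      then show False using assms(18)[OF t] by simp
    qed
  qed (fact f' div evol assms(16) assms(17))+
  show ?thesis
  proof (intro allI impI exI conjI)
    fix t :: real assume t: "t \<ge> 0"
    show "((\<lambda>s. energy w \<phi> \<psi> (\<lambda>x. f x s)) has_real_derivative
        (LINT x|lebesgue. K t x * f' (x, t) (0, 1))) (at t within {0..})"
      unfolding K_def
      by (intro energy_has_derivative t assms differentiable_imp_continuous_on \<psi>_even)
    have "GDERIV (K t) y :> gradient (K t) y" for y
      using K_diff[OF t] by (intro GDERIV_gradient) (auto simp: differentiable_on_def)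
    from dissipation_identity[OF t this]
    show "(LINT x|lebesgue. K t x * f' (x, t) (0, 1)) \<le> 0"
      using assms(16)[OF t] by (simp add: integral_nonneg_AE)
  qed
qed

end
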